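(* Let $G=(V,D)$ be an acyclic process graph with underlying time series graph $\mathcal G\in\mathcal T(G)$, let $X,Y\subset V$ be not necessarily disjoint subsets, and let $(\Phi,\Omega)\in\mathbb R^{\mathcal G}_{\mathrm{stb}}$ be an SVAR-parameter pair. Then the matrix $[\mathcal S(\Phi,\Omega)]_{X,Y}$ over the field $\mathbb R(z)$ has rank less than or equal to $r$ if and only if there exist subsets $Z_X,Z_Y\subset V$ with $|Z_X|+|Z_Y|\le r$ such that $(Z_X,Z_Y)$ $t$-separates $X$ from $Y$. Generically, $[\mathcal S_G]_{X,Y}$ is of rank $$\min\{|Z_X|+|Z_Y| \;:\; (Z_X,Z_Y)\text{ $t$-separates }X\text{ from }Y\}.$$
   Context: **Graphs.** Let $V$ be a finite set. A (stationary) time series graph over $V$ is a directed graph $\mathcal G=(V\times\mathbb Z,\mathcal D)$ such that whenever $(v(t-k),w(t))\in\mathcal D$ (an edge from $(v,t-k)$ to $(w,t)$), then $k\ge 0$ and $(v(s-k),w(s))\in\mathcal D$ for all $s\in\mathbb Z$; this is written $v\to_k w$. All time series graphs have finite order, i.e. $\max\{k: v\to_k w\}<\infty$. Auto-lags $v\to_k v$ are allowed. The process graph of $\mathcal G$ is the finite directed graph $G=(V,D)$ containing the edge $v\to w$ ($v\ne w$) iff $v\to_k w$ for some $k\ge0$ (auto-lags do not count as edges of $G$). $\mathcal T(G)$ is the set of all time series graphs with process graph $G$. **Parameters.** $\mathbb R^{\mathcal D}$ is the finite-dimensional space of coefficient families $\Phi=(\phi_{v,w}(k))_{v\to_k w}$.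 $\mathbb R^{\mathcal D}_{\mathrm{stb}}$ is the set of $\Phi$ with $\sum_{k}|\phi_{v,v}(k)|<1$ for every $v\in V$ and $\sum_{v,w\in V}\sum_{k:v\to_k w}|\phi_{v,w}(k)|<1$. $\mathbb R^{\mathcal G}_{\mathrm{stb}}=\mathbb R^{\mathcal D}_{\mathrm{stb}}\times\mathbb R^V_+$, where $\mathbb R^V_+$ is the set of diagonal matrices $\Omega=\mathrm{diag}((\omega_v)_{v\in V})$ with $\omega_v>0$. **Spectrum.** For $q\in\mathbb R(z)$ put $q^*(z)=q(z^{-1})\in\mathbb R(z)$; apply $*$ to matrices entrywise. Let $\varphi_{x,y}(z)=\sum_{k:x\to_k y}\phi_{x,y}(k)z^k$. The transfer function $H\in\mathbb R(z)^{V\times V}$ has entries $h_{v,w}=\varphi_{v,w}/(1-\varphi_{w,w})$ if $v\to w$ in $G$ and $0$ otherwise. The internal spectrum $\mathcal S^{\mathrm I}$ is the diagonal matrix with entries $\mathcal S^{\mathrm I}_v=\omega_v\,(1-\varphi_{v,v})^{-1}\left((1-\varphi_{v,v})^{-1}\right)^*$. The spectrum is $\mathcal S(\Phi,\Omega)=\mathcal S_{\mathcal G}(\Phi,\Omega)=(I-H)^{-\top}\mathcal S^{\mathrm I}(I-H^* )^{-1}\in\mathbb R(z)^{V\times V}$. $[M]_{X,Y}$ denotes the submatrix with rows $X$ and columns $Y$. **Generic rank.** $[\mathcal S_{\mathcal G}]_{X,Y}$ is of rank $r$ generically if the set of $(\Phi,\Omega)\in\mathbb R^{\mathcal G}_{\mathrm{stb}}$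 for which $[\mathcal S_{\mathcal G}(\Phi,\Omega)]_{X,Y}$ does not have rank $r$ over $\mathbb R(z)$ has Lebesgue measure zero. $[\mathcal S_G]_{X,Y}$ is of rank $r$ generically if $[\mathcal S_{\mathcal G}]_{X,Y}$ is of rank $r$ generically for each $\mathcal G\in\mathcal T(G)$. **Treks and $t$-separation.** A trek from $v$ to $w$ on $G$ is a triple $\tau=(\mathrm{Left}(\tau),\mathrm{top}(\tau),\mathrm{Right}(\tau))$ where $\mathrm{top}(\tau)\in V$, $\mathrm{Left}(\tau)$ is a directed path from $\mathrm{top}(\tau)$ to $v$ and $\mathrm{Right}(\tau)$ is a directed path from $\mathrm{top}(\tau)$ to $w$ (paths may be empty, i.e. consist of a single vertex). For not necessarily disjoint $X,Y,Z_X,Z_Y\subset V$, $(Z_X,Z_Y)$ $t$-separates $X$ from $Y$ if for every trek $\tau$ from some $x\in X$ to some $y\in Y$, either $\mathrm{Left}(\tau)$ contains a vertex of $Z_X$ or $\mathrm{Right}(\tau)$ contains a vertex of $Z_Y$.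
   Formalization: The first equivalence is stated with "rank ≤ r for all stable (Φ,Ω)" on the left instead of for one fixed (Φ,Ω), since for fixed parameters it fails (single edge v→w, Φ=0: rank 0, but no t-separating pair of size 0). *)

theory Defs
  imports
    "HOL-Analysis.Analysis"
    "HOL-Computational_Algebra.Polynomial_Factorial"
begin

text \<open>
  The finite vertex set \<open>V\<close> is a type \<open>'v\<close> of class \<^class>\<open>finite\<close>; subsets of \<open>V\<close> are terms of type
  \<open>'v set\<close>.
\<close>

type_synonym 'v tsgraph = "(('v \<times> int) \<times> ('v \<times> int)) set"

definition lag_edge :: "'v tsgraph \<Rightarrow> 'v \<Rightarrow> 'v \<Rightarrow> nat \<Rightarrow> bool" where
  "lag_edge E v w k \<longleftrightarrow> (\<exists>t. ((v, t - int k), (w, t)) \<in> E)"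

definition time_series_graph :: "'v tsgraph \<Rightarrow> bool" where
  "time_series_graph E \<longleftrightarrow>
     (\<forall>v w k t. ((v, t - k), (w, t)) \<in> E \<longrightarrow> k \<ge> 0 \<and> (\<forall>s. ((v, s - k), (w, s)) \<in> E)) \<and>
     (\<exists>p. \<forall>v w k. lag_edge E v w k \<longrightarrow> k \<le> p)"

definition process_graph :: "'v tsgraph \<Rightarrow> 'v rel" where
  "process_graph E = {(v, w). v \<noteq> w \<and> (\<exists>k. lag_edge E v w k)}"

definition time_series_graphs :: "'v rel \<Rightarrow> 'v tsgraph set" where
  "time_series_graphs G = {E. time_series_graph E \<and> process_graph E = G}"

text \<open>
  A coefficient family \<open>\<Phi>\<close> is an extensional function on the finite index set of all triples
  \<open>(v, w, k)\<close> for which there is an edge from \<open>v\<close> to \<open>w\<close> at lag \<open>k\<close>. A diagonal matrix \<open>\<Omega>\<close> is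
  represented by the function \<open>\<omega>\<close> listing its diagonal.
\<close>

definition coeff_index :: "'v tsgraph \<Rightarrow> ('v \<times> 'v \<times> nat) set" where
  "coeff_index E = {(v, w, k). lag_edge E v w k}"

lemma finite_coeff_index:
  fixes E :: "'v::finite tsgraph"
  assumes "time_series_graph E"
  shows "finite (coeff_index E)"
proof -
  obtain p where "\<forall>v w k. lag_edge E v w k \<longrightarrow> k \<le> p"
    using assms unfolding time_series_graph_def by blast
  then have "coeff_index E \<subseteq> UNIV \<times> UNIV \<times> {..p}"
    by (auto simp: coeff_index_def)
  then show ?thesis
    by (rule finite_subset) simp
qed

definition coeff_space :: "'v tsgraph \<Rightarrow> ('v \<times> 'v \<times> nat \<Rightarrow> real) set" where
  "coeff_space E = coeff_index E \<rightarrow>\<^sub>E UNIV"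

definition stable_coeffs :: "'v::finite tsgraph \<Rightarrow> ('v \<times> 'v \<times> nat \<Rightarrow> real) set" where
  "stable_coeffs E = {\<Phi> \<in> coeff_space E.
     (\<forall>v. (\<Sum>k | lag_edge E v v k. \<bar>\<Phi> (v, v, k)\<bar>) < 1) \<and>
     (\<Sum>v\<in>UNIV. \<Sum>w\<in>UNIV. \<Sum>k | lag_edge E v w k. \<bar>\<Phi> (v, w, k)\<bar>) < 1}"

definition stable_params ::
    "'v::finite tsgraph \<Rightarrow> (('v \<times> 'v \<times> nat \<Rightarrow> real) \<times> ('v \<Rightarrow> real)) set" where
  "stable_params E = stable_coeffs E \<times> {\<omega>. \<forall>v. \<omega> v > 0}"

definition param_measure ::
    "'v::finite tsgraph \<Rightarrow> (('v \<times> 'v \<times> nat \<Rightarrow> real) \<times> ('v \<Rightarrow> real)) measure" where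
  "param_measure E =
     completion (PiM (coeff_index E) (\<lambda>_. lborel) \<Otimes>\<^sub>M PiM UNIV (\<lambda>_. lborel))"

text \<open>
  The field of real rational functions in \<open>z\<close> is \<^typ>\<open>real poly fract\<close>.
  First we define \<open>p(1/z)\<close> for a polynomial \<open>p\<close>; it is nonzero for \<open>p \<noteq> 0\<close>, so that
  \<open>q(z) \<mapsto> q(1/z)\<close> is well-defined on quotients of polynomials.
\<close>

abbreviation ratfun_const :: "real \<Rightarrow> real poly fract" where
  "ratfun_const c \<equiv> to_fract [:c:]"

abbreviation ratfun_z :: "real poly fract" where
  "ratfun_z \<equiv> to_fract [:0, 1:]"

definition poly_at_inverse_z :: "real poly \<Rightarrow> real poly fract" where
  "poly_at_inverse_z p = poly (map_poly ratfun_const p) (inverse ratfun_z)"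

lemma poly_map_poly_ratfun_z: "poly (map_poly ratfun_const p) ratfun_z = to_fract p"
proof (induction p)
  case 0
  show ?case by simp
next
  case (pCons a p)
  have "pCons a p = [:a:] + [:0, 1:] * p"
    by simp
  then have "to_fract (pCons a p) = ratfun_const a + ratfun_z * to_fract p"
    by (metis to_fract_add to_fract_mult)
  with pCons show ?case
    by (simp add: map_poly_pCons)
qed

lemma poly_at_inverse_z_nonzero:
  assumes "p \<noteq> 0"
  shows "poly_at_inverse_z p \<noteq> 0"
proof -
  let ?P = "map_poly ratfun_const p"
  have z: "ratfun_z \<noteq> 0"
    by simp
  have deg: "degree ?P = degree p"
    by (rule degree_map_poly) simp
  have "reflect_poly ?P = map_poly ratfun_const (reflect_poly p)"
    by (rule poly_eqI) (simp add: coeff_reflect_poly coeff_map_poly deg)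
  then have "to_fract (reflect_poly p) = ratfun_z ^ degree ?P * poly_at_inverse_z p"
    using poly_reflect_poly_nz[OF z, of ?P] poly_map_poly_ratfun_z[of "reflect_poly p"]
    by (simp add: poly_at_inverse_z_def)
  moreover have "to_fract (reflect_poly p) \<noteq> 0"
    using assms by simp
  ultimately show ?thesis
    by auto
qed

lemma poly_at_inverse_z_mult:
  "poly_at_inverse_z (p * q) = poly_at_inverse_z p * poly_at_inverse_z q"
proof -
  have "map_poly ratfun_const (p * q) = map_poly ratfun_const p * map_poly ratfun_const q"
  proof (rule poly_eqI)
    fix n
    have add: "ratfun_const (a + b) = ratfun_const a + ratfun_const b" for a b
      by (simp flip: to_fract_add)
    have hom: "ratfun_const (sum f A) = (\<Sum>i\<in>A. ratfun_const (f i))" if "finite A" for f and A :: "nat set"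
      using that by induction (simp_all add: add del: to_fract_add)
    have mul: "ratfun_const (a * b) = ratfun_const a * ratfun_const b" for a b
      by (simp flip: to_fract_mult)
    show "coeff (map_poly ratfun_const (p * q)) n =
        coeff (map_poly ratfun_const p * map_poly ratfun_const q) n"
      by (simp add: coeff_map_poly coeff_mult hom mul)
  qed
  then show ?thesis
    by (simp add: poly_at_inverse_z_def)
qed

definition ratfun_star :: "real poly fract \<Rightarrow> real poly fract" where
  "ratfun_star q = (THE s. \<exists>a b. b \<noteq> 0 \<and> q = Fract a b \<and>
     s = poly_at_inverse_z a / poly_at_inverse_z b)"

lemma ratfun_star_Fract:
  assumes "b \<noteq> 0"
  shows "ratfun_star (Fract a b) = poly_at_inverse_z a / poly_at_inverse_z b"
  unfolding ratfun_star_def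
proof (rule the_equality)
  show "\<exists>a' b'. b' \<noteq> 0 \<and> Fract a b = Fract a' b' \<and>
      poly_at_inverse_z a / poly_at_inverse_z b = poly_at_inverse_z a' / poly_at_inverse_z b'"
    using assms by blast
next
  fix s
  assume "\<exists>a' b'. b' \<noteq> 0 \<and> Fract a b = Fract a' b' \<and>
      s = poly_at_inverse_z a' / poly_at_inverse_z b'"
  then obtain a' b' where *: "b' \<noteq> 0" "Fract a b = Fract a' b'"
      "s = poly_at_inverse_z a' / poly_at_inverse_z b'"
    by blast
  then have "a * b' = a' * b"
    using assms by (simp add: eq_fract)
  then have "poly_at_inverse_z a * poly_at_inverse_z b' =
      poly_at_inverse_z a' * poly_at_inverse_z b"
    by (simp flip: poly_at_inverse_z_mult)
  then show "s = poly_at_inverse_z a / poly_at_inverse_z b"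
    using * assms by (simp add: poly_at_inverse_z_nonzero frac_eq_eq)
qed

definition lag_poly ::
    "'v tsgraph \<Rightarrow> ('v \<times> 'v \<times> nat \<Rightarrow> real) \<Rightarrow> 'v \<Rightarrow> 'v \<Rightarrow> real poly fract" where
  "lag_poly E \<Phi> x y = (\<Sum>k | lag_edge E x y k. ratfun_const (\<Phi> (x, y, k)) * ratfun_z ^ k)"

definition transfer_function ::
    "'v::finite tsgraph \<Rightarrow> ('v \<times> 'v \<times> nat \<Rightarrow> real) \<Rightarrow> real poly fract ^ 'v ^ 'v" where
  "transfer_function E \<Phi> = (\<chi> v w.
     if (v, w) \<in> process_graph E then lag_poly E \<Phi> v w / (1 - lag_poly E \<Phi> w w) else 0)"

definition internal_spectrum ::
    "'v::finite tsgraph \<Rightarrow> ('v \<times> 'v \<times> nat \<Rightarrow> real) \<Rightarrow> ('v \<Rightarrow> real) \<Rightarrow> real poly fract ^ 'v ^ 'v" where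
  "internal_spectrum E \<Phi> \<omega> = (\<chi> v w.
     if v = w
     then ratfun_const (\<omega> v) * inverse (1 - lag_poly E \<Phi> v v) *
          ratfun_star (inverse (1 - lag_poly E \<Phi> v v))
     else 0)"

definition spectrum ::
    "'v::finite tsgraph \<Rightarrow> ('v \<times> 'v \<times> nat \<Rightarrow> real) \<Rightarrow> ('v \<Rightarrow> real) \<Rightarrow> real poly fract ^ 'v ^ 'v" where
  "spectrum E \<Phi> \<omega> =
     transpose (matrix_inv (mat 1 - transfer_function E \<Phi>)) **
     internal_spectrum E \<Phi> \<omega> **
     matrix_inv (mat 1 - map_matrix ratfun_star (transfer_function E \<Phi>))"

text \<open>
  The submatrix with rows \<open>X\<close> and columns \<open>Y\<close> is padded with zero rows and columns to the full
  index type; this does not affect its rank.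
\<close>

definition submatrix_of :: "'a::zero ^ 'n ^ 'm \<Rightarrow> 'm set \<Rightarrow> 'n set \<Rightarrow> 'a ^ 'n ^ 'm" where
  "submatrix_of M X Y = (\<chi> i j. if i \<in> X \<and> j \<in> Y then M $ i $ j else 0)"

definition spectrum_rank ::
    "'v::finite tsgraph \<Rightarrow> ('v \<times> 'v \<times> nat \<Rightarrow> real) \<Rightarrow> ('v \<Rightarrow> real) \<Rightarrow> 'v set \<Rightarrow> 'v set \<Rightarrow> nat" where
  "spectrum_rank E \<Phi> \<omega> X Y = rank (submatrix_of (spectrum E \<Phi> \<omega>) X Y)"

definition generic_rank_ts :: "'v::finite tsgraph \<Rightarrow> 'v set \<Rightarrow> 'v set \<Rightarrow> nat \<Rightarrow> bool" where
  "generic_rank_ts E X Y r \<longleftrightarrow>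
     {(\<Phi>, \<omega>) \<in> stable_params E. spectrum_rank E \<Phi> \<omega> X Y \<noteq> r} \<in> null_sets (param_measure E)"

definition generic_rank :: "'v::finite rel \<Rightarrow> 'v set \<Rightarrow> 'v set \<Rightarrow> nat \<Rightarrow> bool" where
  "generic_rank G X Y r \<longleftrightarrow> (\<forall>E \<in> time_series_graphs G. generic_rank_ts E X Y r)"

text \<open>
  A directed path is given by its nonempty list of vertices. Vertices are not required to be
  distinct; on an acyclic graph they automatically are.
\<close>

definition directed_path :: "'v rel \<Rightarrow> 'v \<Rightarrow> 'v list \<Rightarrow> 'v \<Rightarrow> bool" where
  "directed_path G a p b \<longleftrightarrow>
     p \<noteq> [] \<and> hd p = a \<and> last p = b \<and> successively (\<lambda>u v. (u, v) \<in> G) p"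

definition trek :: "'v rel \<Rightarrow> 'v \<Rightarrow> 'v list \<times> 'v \<times> 'v list \<Rightarrow> 'v \<Rightarrow> bool" where
  "trek G v \<tau> w = (case \<tau> of (l, u, r) \<Rightarrow>
     directed_path G u l v \<and> directed_path G u r w)"

definition t_separates :: "'v rel \<Rightarrow> 'v set \<Rightarrow> 'v set \<Rightarrow> 'v set \<Rightarrow> 'v set \<Rightarrow> bool" where
  "t_separates G ZX ZY X Y \<longleftrightarrow>
     (\<forall>x\<in>X. \<forall>y\<in>Y. \<forall>l u r. trek G x (l, u, r) y \<longrightarrow>
        set l \<inter> ZX \<noteq> {} \<or> set r \<inter> ZY \<noteq> {})"

end

theory Submission
  imports Defs
begin

text \<open>
  Write \<open>H\<close> for the transfer function,
  \<open>A\<close> for the inverse of \<open>I - H\<close> and \<open>A'\<close> for that of \<open>I - H*\<close>. The entry of \<open>A\<close> at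
  \<open>(u, x)\<close> is the sum of the gains of all directed paths from \<open>u\<close> to \<open>x\<close>, so the entry of the
  spectrum at \<open>(x, y)\<close> is a sum over treks from \<open>x\<close> to \<open>y\<close>.

  \<^bold>\<open>Upper bound.\<close> Let \<open>(ZX, ZY)\<close> t-separate \<open>X\<close> from \<open>Y\<close>. Splitting each path at its first vertex
  in \<open>ZX\<close> gives \<open>A = P + C A\<close>, where \<open>P\<close> collects the paths that avoid \<open>ZX\<close> and \<open>C\<close> has only columns in
  \<open>ZX\<close>; likewise \<open>A' = Q + C' A'\<close> for \<open>ZY\<close>. In the sum over treks the part with \<open>P\<close> on the left and
  \<open>Q\<close> on the right vanishes on \<open>X \<times> Y\<close>, and the two other parts factor through index sets of size
  \<open>card ZX\<close> and \<open>card ZY\<close>. This holds for every choice of the parameters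
  (\<open>rank_le_if_t_separates\<close>).

  \<^bold>\<open>Lower bound.\<close> A minor over the rational functions is nonzero as soon as its value at \<open>z = 1\<close> is.
  At \<open>z = 1\<close> the substitution of \<open>1/z\<close> for \<open>z\<close> is invisible, and stability excludes poles, so it is
  enough to study the real matrix \<open>transpose A ** D ** A\<close> with a diagonal matrix \<open>D\<close> (\<open>card_le_spectrum_rank\<close>).
  Its minors are rational functions of the parameters, and a rational function that is nonzero at one
  point is nonzero almost everywhere (\<open>AE_polyfun_nonzero_pair\<close>). It remains to find that
  point. Let \<open>m\<close> be the least size of a t-separating pair. In the graph with two copies of every vertex,
  one for the left and one for the right sides of treks, a t-separating pair is a vertex separator,
  so Menger's theorem gives \<open>m\<close> vertex-disjoint paths (\<open>trek_systems_exist\<close>). They provide a set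
  \<open>U\<close> of \<open>m\<close> top vertices, a system of disjoint paths from \<open>U\<close> to \<open>X\<close> and one from \<open>U\<close> to \<open>Y\<close>. With \<open>D\<close> the
  indicator of \<open>U\<close> the minor is a product of a determinant for the left and one for the right side
  (\<open>bordered_minor_factor\<close>). Each factor equals \<open>1\<close> when exactly the edges of its own
  path system are switched on; left and right paths may share edges, so this takes two
  different parameter points, but on the line through these points each factor has only finitely
  many zeros, and some point of the line serves both (\<open>nonsingular_minor_exists\<close>).

  The two bounds give the generic rank. For the equivalence, the set of stable parameters contains
  points off the zero set, because this set meets a line through a stable point in finitely many points.
\<close>

section \<open>Vertex-disjoint paths and separators\<close>

text \<open>
  A path that meets \<open>C\<close> nowhere is a chain of edges whose two ends both lie outside \<open>C\<close>; the starting
  vertex is required to lie outside \<open>C\<close> because the empty chain has no edges that would exclude it.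
\<close>

definition separates :: "'a rel \<Rightarrow> 'a set \<Rightarrow> 'a set \<Rightarrow> 'a set \<Rightarrow> bool" where
  "separates D A B C \<longleftrightarrow> (\<forall>a\<in>A - C. \<forall>b\<in>B - C. (a, b) \<notin> (D \<inter> (-C) \<times> (-C))\<^sup>*)"

text \<open>
  A family of vertex-disjoint paths from \<open>S \<subseteq> A\<close> to \<open>B\<close>, encoded by the set \<open>F\<close> of all its edges. Every
  vertex has at most one outgoing and one incoming edge in \<open>F\<close>, starting vertices have no incoming and final
  vertices no outgoing edge; hence maximal \<open>F\<close>-chains from different elements of \<open>S\<close> cannot meet. The last
  conjunct excludes edges of \<open>F\<close> outside these chains.
\<close>

definition linking :: "'a rel \<Rightarrow> 'a set \<Rightarrow> 'a set \<Rightarrow> 'a rel \<Rightarrow> 'a set \<Rightarrow> bool" where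
  "linking D A B F S \<longleftrightarrow>
     F \<subseteq> D \<and> single_valued F \<and> single_valued (F\<inverse>) \<and> S \<subseteq> A \<and> S \<inter> Range F = {} \<and>
     (\<forall>a\<in>S. \<exists>b\<in>B - Domain F. (a, b) \<in> F\<^sup>*) \<and> Domain F \<subseteq> F\<^sup>* `` S"

text \<open>
  A deterministic relation can be followed in one way only, so every vertex on the way from \<open>a\<close> leads on
  to the vertex at which the walk from \<open>a\<close> gets stuck.
\<close>

lemma single_valued_rtrancl_terminal:
  assumes "single_valued F" "(a, v) \<in> F\<^sup>*" "(a, b) \<in> F\<^sup>*" "b \<notin> Domain F"
  shows "(v, b) \<in> F\<^sup>*"
  using assms(2)
proof (induction rule: rtrancl_induct)
  case base
  show ?case using assms(3) .
next
  case (step y z)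
  then have "y \<noteq> b" using assms(4) by blast
  with step.IH obtain y' where "(y, y') \<in> F" "(y', b) \<in> F\<^sup>*"
    by (metis converse_rtranclE)
  with step.hyps assms(1) show ?case by (auto dest: single_valuedD)
qed

lemma terminal_unique:
  assumes "single_valued F" "(a, b) \<in> F\<^sup>*" "(a, b') \<in> F\<^sup>*" "b \<notin> Domain F" "b' \<notin> Domain F"
  shows "b = b'"
  using single_valued_rtrancl_terminal[OF assms(1,2,3,5)] assms(4)
  by (metis DomainI converse_rtranclE)

text \<open>
  Walking backwards from a final vertex is deterministic as well, so two paths with the same final vertex
  start at the same vertex.
\<close>

lemma linking_terminals:
  assumes "linking D A B F S"
  obtains t where "inj_on t S" "\<And>a. a \<in> S \<Longrightarrow> t a \<in> B - Domain F" "\<And>a. a \<in> S \<Longrightarrow> (a, t a) \<in> F\<^sup>*"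
proof -
  have F: "single_valued (F\<inverse>)" "S \<inter> Range F = {}" "\<forall>a\<in>S. \<exists>b\<in>B - Domain F. (a, b) \<in> F\<^sup>*"
    using assms by (auto simp: linking_def)
  then obtain t where t: "\<And>a. a \<in> S \<Longrightarrow> t a \<in> B - Domain F" "\<And>a. a \<in> S \<Longrightarrow> (a, t a) \<in> F\<^sup>*"
    by metis
  have "a = a'" if "a \<in> S" "a' \<in> S" "t a = t a'" for a a'
  proof -
    have "(t a, a) \<in> (F\<inverse>)\<^sup>*" "(t a, a') \<in> (F\<inverse>)\<^sup>*"
      using t(2) that by (metis rtrancl_converseI)+
    then show ?thesis
      using terminal_unique[OF F(1)] F(2) that by (metis Domain_converse IntI empty_iff)
  qed
  then have "inj_on t S" by (rule inj_onI)
  from that[OF this t] show ?thesis .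
qed

text \<open>
  Deleting the edge \<open>(x, y)\<close> can be compensated by blocking one of its ends.
\<close>

lemma separates_insert_endpoint:
  assumes "separates (D - {(x, y)}) A B S"
  shows "separates D A B (insert x S)" "separates D A B (insert y S)"
proof -
  have *: "D \<inter> (- insert x S) \<times> (- insert x S) \<subseteq> (D - {(x, y)}) \<inter> (-S) \<times> (-S)"
          "D \<inter> (- insert y S) \<times> (- insert y S) \<subseteq> (D - {(x, y)}) \<inter> (-S) \<times> (-S)" by auto
  show "separates D A B (insert x S)" "separates D A B (insert y S)"
    using assms *[THEN rtrancl_mono] unfolding separates_def by blast+
qed

text \<open>
  A path from \<open>A\<close> to \<open>B\<close> must meet \<open>insert x S\<close>, and up to its first vertex there it cannot have used an
  edge that starts at \<open>x\<close>. So this initial piece already meets \<open>C\<close>.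
\<close>

lemma separates_via_source:
  assumes S: "separates D A B (insert x S)"
      and C: "separates (D - {(x, y)}) A (insert x S) C"
  shows "separates D A B C"
  unfolding separates_def
proof (intro ballI notI)
  fix a b assume a: "a \<in> A - C" and b: "b \<in> B - C" and ab: "(a, b) \<in> (D \<inter> (-C) \<times> (-C))\<^sup>*"
  have aS: "a \<notin> insert x S"
    using C a unfolding separates_def by blast
  have "v \<notin> insert x S \<and> (a, v) \<in> (D \<inter> (- insert x S) \<times> (- insert x S))\<^sup>*
      \<and> (a, v) \<in> ((D - {(x, y)}) \<inter> (-C) \<times> (-C))\<^sup>*"
    if "(a, v) \<in> (D \<inter> (-C) \<times> (-C))\<^sup>*" for v
    using that
  proof (induction rule: rtrancl_induct)
    case base
    show ?case using aS by blast
  next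
    case (step v w)
    then have "(v, w) \<in> (D - {(x, y)}) \<inter> (-C) \<times> (-C)" by blast
    with step.IH have "(a, w) \<in> ((D - {(x, y)}) \<inter> (-C) \<times> (-C))\<^sup>*"
      by (meson rtrancl.rtrancl_into_rtrancl)
    moreover from this have "w \<notin> insert x S"
      using C a step.hyps unfolding separates_def by blast
    moreover from this have "(v, w) \<in> D \<inter> (- insert x S) \<times> (- insert x S)"
      using step by blast
    ultimately show ?case
      using step.IH by (meson rtrancl.rtrancl_into_rtrancl)
  qed
  with ab show False
    using S a b aS unfolding separates_def by blast
qed

lemma separates_converse: "separates (D\<inverse>) B A C \<longleftrightarrow> separates D A B C"
proof -
  have "D\<inverse> \<inter> (-C) \<times> (-C) = (D \<inter> (-C) \<times> (-C))\<inverse>" by auto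
  then show ?thesis
    unfolding separates_def by (simp add: rtrancl_converse) blast
qed

lemma separates_via_target:
  assumes S: "separates D A B (insert y S)"
      and C: "separates (D - {(x, y)}) (insert y S) B C"
  shows "separates D A B C"
proof -
  have "(D - {(x, y)})\<inverse> = D\<inverse> - {(y, x)}" by auto
  with assms have "separates (D\<inverse>) B A (insert y S)" "separates (D\<inverse> - {(y, x)}) B (insert y S) C"
    by (simp_all add: separates_converse flip: \<open>(D - {(x, y)})\<inverse> = D\<inverse> - {(y, x)}\<close>)
  then show ?thesis
    using separates_via_source separates_converse by metis
qed

lemma rtrancl_avoids_if_Domain_avoids:
  assumes "(a, v) \<in> F\<^sup>*" "v \<notin> S" "Domain F \<inter> S = {}"
  shows "(a, v) \<in> (F \<inter> (-S) \<times> (-S))\<^sup>*"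
  using assms(1,2)
proof (induction rule: rtrancl_induct)
  case base
  show ?case by blast
next
  case (step u v)
  then have "u \<notin> S" using assms(3) by blast
  then have "(a, u) \<in> (F \<inter> (-S) \<times> (-S))\<^sup>*" "(u, v) \<in> F \<inter> (-S) \<times> (-S)" using step by auto
  then show ?case by (rule rtrancl.rtrancl_into_rtrancl)
qed

text \<open>
  The gluing step of Goering's proof of Menger's theorem. The sets \<open>insert x S\<close> and \<open>insert y S\<close> have as
  many elements as the two families have paths, so each of their elements is the end of a path of the
  first family, respectively the beginning of one of the second. A vertex common to both families lies in \<open>S\<close>,
  since otherwise it would give a path from \<open>A\<close> to \<open>B\<close> that avoids \<open>S\<close>. Hence the families fit together
  along \<open>S\<close> and the edge \<open>(x, y)\<close> without creating new intersections.
\<close>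

lemma linking_join:
  assumes sep: "separates (D - {(x, y)}) A B S"
    and xy: "(x, y) \<in> D" and x: "x \<notin> S" and y: "y \<notin> S" and fin: "finite S"
    and L1: "linking (D - {(x, y)}) A (insert x S) F1 A1" and c1: "card A1 = Suc (card S)"
    and L2: "linking (D - {(x, y)}) (insert y S) B F2 A2" and c2: "card A2 = Suc (card S)"
  shows "linking D A B (insert (x, y) (F1 \<union> F2)) A1"
proof -
  let ?F = "insert (x, y) (F1 \<union> F2)"
  have F1: "F1 \<subseteq> D - {(x, y)}" "single_valued F1" "single_valued (F1\<inverse>)" "A1 \<subseteq> A"
      "A1 \<inter> Range F1 = {}" "Domain F1 \<subseteq> F1\<^sup>* `` A1"
    using L1 by (auto simp: linking_def)
  have F2: "F2 \<subseteq> D - {(x, y)}" "single_valued F2" "single_valued (F2\<inverse>)" "A2 \<subseteq> insert y S"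
      "A2 \<inter> Range F2 = {}" "Domain F2 \<subseteq> F2\<^sup>* `` A2" "\<forall>a\<in>A2. \<exists>b\<in>B - Domain F2. (a, b) \<in> F2\<^sup>*"
    using L2 by (auto simp: linking_def)
  obtain t where t: "inj_on t A1" "\<And>a. a \<in> A1 \<Longrightarrow> t a \<in> insert x S - Domain F1"
      "\<And>a. a \<in> A1 \<Longrightarrow> (a, t a) \<in> F1\<^sup>*"
    using linking_terminals[OF L1] by metis
  have tA1: "t ` A1 = insert x S"
    by (rule card_subset_eq) (use fin t(2) x c1 card_image[OF t(1)] in auto)
  have A2: "A2 = insert y S"
    using F2(4) y c2 fin by (intro card_subset_eq) simp_all
  \<comment> \<open>The vertex sets of the two families.\<close>
  define W1 where "W1 = F1\<^sup>* `` A1"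
  define W2 where "W2 = F2\<^sup>* `` A2"
  have D1: "Domain F1 \<inter> insert x S = {}"
  proof -
    have "t a \<notin> Domain F1" if "a \<in> A1" for a using t(2)[OF that] by blast
    then show ?thesis unfolding tA1[symmetric] by blast
  qed
  have W1: "Domain F1 \<subseteq> W1" "Range F1 \<subseteq> W1" "A1 \<subseteq> W1" "insert x S \<subseteq> W1"
  proof -
    show dom: "Domain F1 \<subseteq> W1" using F1(6) by (simp add: W1_def)
    show "Range F1 \<subseteq> W1"
      using dom unfolding W1_def by (blast intro: rtrancl.rtrancl_into_rtrancl)
    show "A1 \<subseteq> W1" unfolding W1_def by blast
    show "insert x S \<subseteq> W1" using t(3) unfolding W1_def tA1[symmetric] by blast
  qed
  have W2: "Domain F2 \<subseteq> W2" "Range F2 \<subseteq> W2" "insert y S \<subseteq> W2"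
  proof -
    show dom: "Domain F2 \<subseteq> W2" using F2(6) by (simp add: W2_def)
    show "Range F2 \<subseteq> W2"
      using dom unfolding W2_def by (blast intro: rtrancl.rtrancl_into_rtrancl)
    show "insert y S \<subseteq> W2" unfolding W2_def A2[symmetric] by blast
  qed
  have common: "v \<in> S" if v: "v \<in> W1" "v \<in> W2" for v
  proof (rule ccontr)
    assume vS: "v \<notin> S"
    obtain a where a: "a \<in> A1" "(a, v) \<in> F1\<^sup>*" using v by (auto simp: W1_def)
    have av: "(a, v) \<in> (F1 \<inter> (-S) \<times> (-S))\<^sup>*"
      by (rule rtrancl_avoids_if_Domain_avoids) (use a vS D1 in auto)
    obtain s where s: "s \<in> A2" "(s, v) \<in> F2\<^sup>*" using v by (auto simp: W2_def)
    obtain b where b: "b \<in> B - Domain F2" "(s, b) \<in> F2\<^sup>*" using F2(7) s by blast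
    have "(v, b) \<in> F2\<^sup>*"
      using single_valued_rtrancl_terminal F2(2) s b by (metis DiffD2)
    then have "(b, v) \<in> (F2\<inverse>)\<^sup>*" by (rule rtrancl_converseI)
    then have "(b, v) \<in> (F2\<inverse> \<inter> (-S) \<times> (-S))\<^sup>*"
      by (rule rtrancl_avoids_if_Domain_avoids) (use vS F2(5) A2 in auto)
    moreover have "F2\<inverse> \<inter> (-S) \<times> (-S) = (F2 \<inter> (-S) \<times> (-S))\<inverse>" by auto
    ultimately have vb: "(v, b) \<in> (F2 \<inter> (-S) \<times> (-S))\<^sup>*" by (metis rtrancl_converseD)
    let ?R = "(D - {(x, y)}) \<inter> (-S) \<times> (-S)"
    have "F1 \<inter> (-S) \<times> (-S) \<subseteq> ?R" "F2 \<inter> (-S) \<times> (-S) \<subseteq> ?R"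
      using F1(1) F2(1) by auto
    with av vb have "(a, b) \<in> ?R\<^sup>*"
      by (meson rtrancl_mono rtrancl_trans subsetD)
    moreover have "a \<notin> S" using av vS by (metis ComplD IntE SigmaE2 converse_rtranclE)
    moreover have "b \<notin> S" using vb vS by (metis ComplD IntE SigmaE2 rtranclE)
    ultimately show False
      using sep a(1) b(1) F1(4) unfolding separates_def by blast
  qed
  have yR2: "y \<notin> Range F2" and R2: "Range F2 \<inter> S = {}" using F2(5) A2 by auto
  have xD2: "x \<notin> Domain F2" using common[of x] W1 W2 x by blast
  have yR1: "y \<notin> Range F1" using common[of y] W1 W2 y by blast
  have D12: "Domain F1 \<inter> Domain F2 = {}" using common W1 W2 D1 by blast
  have R12: "Range F1 \<inter> Range F2 = {}" using common W1 W2 R2 by blast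
  have mono: "F1\<^sup>* \<subseteq> ?F\<^sup>*" "F2\<^sup>* \<subseteq> ?F\<^sup>*" by (rule rtrancl_mono, blast)+
  have reach: "\<exists>a\<in>A1. (a, s) \<in> ?F\<^sup>*" if "s \<in> insert y S" for s
  proof -
    from that tA1 obtain a where a: "a \<in> A1" "t a = s \<or> t a = x \<and> s = y" by (metis imageE insert_iff)
    then have "(a, t a) \<in> ?F\<^sup>*" using t(3) mono by blast
    with a show ?thesis by (blast intro: rtrancl.rtrancl_into_rtrancl)
  qed
  show ?thesis
    unfolding linking_def
  proof (intro conjI ballI)
    show "?F \<subseteq> D" using F1(1) F2(1) xy by auto
    show "single_valued ?F"
      using F1(2) F2(2) D12 D1 xD2 unfolding single_valued_def by blast
    show "single_valued (?F\<inverse>)"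
      using F1(3) F2(3) R12 yR1 yR2 unfolding single_valued_def by blast
    show "A1 \<subseteq> A" by fact
    have "y \<notin> A1" using common[of y] W1 W2 y by blast
    moreover have "A1 \<inter> Range F2 = {}" using common W1 W2 R2 by blast
    ultimately show "A1 \<inter> Range ?F = {}" using F1(5) by auto
    show "Domain ?F \<subseteq> ?F\<^sup>* `` A1"
    proof
      fix u assume "u \<in> Domain ?F"
      then consider "u \<in> W1" | "u \<in> W2" using W1 W2 by auto
      then show "u \<in> ?F\<^sup>* `` A1"
      proof cases
        case 1
        then show ?thesis using mono unfolding W1_def by blast
      next
        case 2
        then obtain s where "s \<in> insert y S" "(s, u) \<in> ?F\<^sup>*" using mono A2 unfolding W2_def by blast
        with reach show ?thesis by (meson ImageI rtrancl_trans)
      qed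
    qed
    fix a assume a: "a \<in> A1"
    define s where "s = (if t a = x then y else t a)"
    have s: "s \<in> A2" using t(2)[OF a] A2 by (auto simp: s_def)
    have as: "(a, s) \<in> ?F\<^sup>*"
    proof (cases "t a = x")
      case True
      then have "(a, x) \<in> ?F\<^sup>*" using t(3)[OF a] mono by auto
      then have "(a, y) \<in> ?F\<^sup>*" by (rule rtrancl.rtrancl_into_rtrancl) blast
      then show ?thesis using True by (simp add: s_def)
    next
      case False
      then show ?thesis using t(3)[OF a] mono by (auto simp: s_def)
    qed
    obtain b where b: "b \<in> B - Domain F2" "(s, b) \<in> F2\<^sup>*" using F2(7) s by blast
    have "b \<in> W2" using b s by (auto simp: W2_def)
    then have "b \<notin> Domain F1" "b \<noteq> x" using common[of b] W1 D1 x by blast+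
    moreover have "(a, b) \<in> ?F\<^sup>*" using as b mono by (meson rtrancl_trans subsetD)
    ultimately show "\<exists>b\<in>B - Domain ?F. (a, b) \<in> ?F\<^sup>*" using b by auto
  qed
qed

text \<open>
  Induction on the number of edges. Delete an edge \<open>(x, y)\<close>. If a separator \<open>S\<close> with fewer than \<open>k\<close>
  elements appears, then \<open>insert x S\<close> and \<open>insert y S\<close> are separators of the original graph, so \<open>S\<close> has
  exactly \<open>k - 1\<close> elements; the induction hypothesis applies to both sides of \<open>S\<close>, and the two families
  are glued.
\<close>

theorem Menger:
  assumes "finite D" "finite A" "finite B"
    and "\<And>C. finite C \<Longrightarrow> separates D A B C \<Longrightarrow> k \<le> card C"
  shows "\<exists>F S. linking D A B F S \<and> card S = k"
  using assms
proof (induction "card D" arbitrary: D A B)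
  case 0
  then have D: "D = {}" by simp
  have "separates D A B (A \<inter> B)" by (auto simp: separates_def D)
  with 0 have "k \<le> card (A \<inter> B)" by blast
  then obtain S where S: "S \<subseteq> A \<inter> B" "card S = k" by (metis obtain_subset_with_card_n)
  then have "linking D A B {} S" by (auto simp: linking_def D)
  with S(2) show ?case by metis
next
  case (Suc n)
  have "D \<noteq> {}" using Suc.hyps(2) by auto
  then obtain x y where xy: "(x, y) \<in> D" by (metis ex_in_conv surj_pair)
  let ?D = "D - {(x, y)}"
  have n: "n = card ?D" and fD: "finite ?D" using Suc.hyps(2) Suc.prems(1) xy by simp_all
  show ?case
  proof (cases "\<forall>C. finite C \<longrightarrow> separates ?D A B C \<longrightarrow> k \<le> card C")
    case True
    then obtain F S where "linking ?D A B F S" "card S = k"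
      using Suc.hyps(1)[OF n fD] Suc.prems by blast
    moreover from this(1) have "linking D A B F S" unfolding linking_def by blast
    ultimately show ?thesis by metis
  next
    case False
    then obtain S where fin: "finite S" and sep: "separates ?D A B S" and less: "card S < k"
      by force
    have sx: "separates D A B (insert x S)" and sy: "separates D A B (insert y S)"
      using separates_insert_endpoint[OF sep] by blast+
    then have "k \<le> card (insert x S)" "k \<le> card (insert y S)"
      using Suc.prems fin by auto
    with less fin have x: "x \<notin> S" and y: "y \<notin> S" and k: "k = Suc (card S)"
      by (auto simp: card_insert_if split: if_splits)
    have "\<exists>F1 A1. linking ?D A (insert x S) F1 A1 \<and> card A1 = k"
      using Suc.hyps(1)[OF n fD, of A "insert x S"] separates_via_source[OF sx] Suc.prems fin by blast
    moreover have "\<exists>F2 A2. linking ?D (insert y S) B F2 A2 \<and> card A2 = k"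
      using Suc.hyps(1)[OF n fD, of "insert y S" B] separates_via_target[OF sy] Suc.prems fin by blast
    ultimately show ?thesis
      using linking_join[OF sep xy x y fin] k by metis
  qed
qed

section \<open>Treks as paths in a doubled graph\<close>

text \<open>
  The left side of a trek is walked against the edges on the \<open>Inl\<close> copies, the right side along the edges
  on the \<open>Inr\<close> copies, and the switch between the copies happens at the top. A trek from \<open>x\<close> to \<open>y\<close> thus becomes
  a path from \<open>Inl x\<close> to \<open>Inr y\<close>, and hitting \<open>ZX\<close> on the left or \<open>ZY\<close> on the right becomes hitting one
  vertex set.
\<close>

definition trek_graph :: "'v rel \<Rightarrow> ('v + 'v) rel" where
  "trek_graph G = {(Inl v, Inl u) | u v. (u, v) \<in> G} \<union> {(Inl u, Inr u) | u. True} \<union>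
     {(Inr u, Inr v) | u v. (u, v) \<in> G}"

lemma directed_path_Cons:
  "directed_path G u (u' # p) w \<longleftrightarrow>
     u' = u \<and> (p = [] \<and> w = u \<or> (\<exists>v. (u, v) \<in> G \<and> directed_path G v p w))"
  by (cases p) (auto simp: directed_path_def successively_Cons)

lemma directed_path_rtrancl:
  "directed_path G u p w \<Longrightarrow> set p \<subseteq> A \<Longrightarrow> u \<in> A \<and> w \<in> A \<and> (u, w) \<in> (G \<inter> A \<times> A)\<^sup>*"
proof (induction p arbitrary: u)
  case Nil
  then show ?case by (simp add: directed_path_def)
next
  case (Cons u' p)
  then consider "p = []" "w = u" "u \<in> A"
    | v where "(u, v) \<in> G" "directed_path G v p w" "u \<in> A" "set p \<subseteq> A"
    by (auto simp: directed_path_Cons)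
  then show ?case
  proof cases
    case 1
    then show ?thesis by simp
  next
    case 2
    with Cons.IH[of v] have IH: "v \<in> A" "w \<in> A" "(v, w) \<in> (G \<inter> A \<times> A)\<^sup>*" by auto
    then have "(u, v) \<in> G \<inter> A \<times> A" using 2 by simp
    with IH 2 show ?thesis by (simp add: converse_rtrancl_into_rtrancl)
  qed
qed

lemma t_separates_of_separates:
  assumes "separates (trek_graph G) (Inl ` X) (Inr ` Y) C"
  shows "t_separates G (Inl -` C) (Inr -` C) X Y"
  unfolding t_separates_def
proof (intro ballI allI impI, rule ccontr)
  fix x y l u r
  assume x: "x \<in> X" and y: "y \<in> Y" and tr: "trek G x (l, u, r) y"
    and not: "\<not> (set l \<inter> Inl -` C \<noteq> {} \<or> set r \<inter> Inr -` C \<noteq> {})"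
  let ?R = "trek_graph G \<inter> (-C) \<times> (-C)"
  let ?A = "- (Inl -` C)" and ?B = "- (Inr -` C)"
  have l: "u \<in> ?A" "x \<in> ?A" "(u, x) \<in> (G \<inter> ?A \<times> ?A)\<^sup>*"
    and r: "u \<in> ?B" "y \<in> ?B" "(u, y) \<in> (G \<inter> ?B \<times> ?B)\<^sup>*"
    using tr not directed_path_rtrancl[of G u l x ?A] directed_path_rtrancl[of G u r y ?B]
    by (auto simp: trek_def)
  have "(Inl x, Inl u) \<in> ?R\<^sup>*" using l(3)
  proof (induction rule: rtrancl_induct)
    case (step v w)
    then have "(Inl w, Inl v) \<in> ?R" by (auto simp: trek_graph_def)
    then show ?case using step.IH by (rule converse_rtrancl_into_rtrancl)
  qed simp
  also have "(Inl u, Inr u) \<in> ?R" using l r by (auto simp: trek_graph_def)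
  also have "(Inr u, Inr y) \<in> ?R\<^sup>*" using r(3)
  proof (induction rule: rtrancl_induct)
    case (step v w)
    then have "(Inr v, Inr w) \<in> ?R" by (auto simp: trek_graph_def)
    with step.IH show ?case by (rule rtrancl.rtrancl_into_rtrancl)
  qed simp
  finally show False
    using assms x y l r unfolding separates_def by blast
qed

text \<open>
  What the determinants use of disjoint paths from the elements \<open>u\<close> of \<open>U\<close> to \<open>g u \<in> X\<close>: along \<open>F\<close>,
  the vertex \<open>g u\<close> is reached from \<open>u\<close> and from no other element of \<open>U\<close>.
\<close>

definition path_system :: "'v rel \<Rightarrow> 'v set \<Rightarrow> 'v set \<Rightarrow> ('v \<Rightarrow> 'v) \<Rightarrow> 'v rel \<Rightarrow> bool" where
  "path_system G U X g F \<longleftrightarrow> F \<subseteq> G \<and> single_valued F \<and> g ` U \<subseteq> X \<and>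
     (\<forall>u\<in>U. \<forall>w\<in>U. (w, g u) \<in> F\<^sup>* \<longleftrightarrow> w = u)"

lemma path_systemI:
  assumes "F \<subseteq> G" "single_valued F" "single_valued (F\<inverse>)" "U \<inter> Range F = {}"
    and g: "\<And>u. u \<in> U \<Longrightarrow> g u \<in> X \<and> (u, g u) \<in> F\<^sup>*"
  shows "path_system G U X g F"
proof -
  have "w = u" if "u \<in> U" "w \<in> U" "(w, g u) \<in> F\<^sup>*" for u w
  proof (rule terminal_unique[OF assms(3)])
    show "(g u, w) \<in> (F\<inverse>)\<^sup>*" "(g u, u) \<in> (F\<inverse>)\<^sup>*" 
      using that g by (auto intro: rtrancl_converseI)
    show "w \<notin> Domain (F\<inverse>)" "u \<notin> Domain (F\<inverse>)" using that assms(4) by auto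
  qed
  then show ?thesis using assms unfolding path_system_def by blast
qed

text \<open>
  There is no edge from an \<open>Inr\<close> vertex back to an \<open>Inl\<close> vertex, so a path crosses exactly once.
\<close>

lemma crossing_vertex:
  assumes "F \<subseteq> trek_graph G" "(Inl x, c) \<in> F\<^sup>*"
  shows "case c of Inl u \<Rightarrow> (u, x) \<in> {(u, v). (Inl v, Inl u) \<in> F}\<^sup>*
    | Inr y \<Rightarrow> \<exists>u. (u, x) \<in> {(u, v). (Inl v, Inl u) \<in> F}\<^sup>* \<and> (Inl u, Inr u) \<in> F \<and>
        (u, y) \<in> {(u, v). (Inr u, Inr v) \<in> F}\<^sup>*"
  using assms(2)
proof (induction rule: rtrancl_induct)
  case base
  show ?case by simp
next
  case (step b c)
  from step.hyps(2) assms(1) have "(b, c) \<in> trek_graph G" by blast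
  then consider u v where "b = Inl v" "c = Inl u" | u where "b = Inl u" "c = Inr u"
    | u v where "b = Inr u" "c = Inr v"
    by (auto simp: trek_graph_def)
  then show ?case
  proof cases
    case 1
    then show ?thesis using step by (auto intro: converse_rtrancl_into_rtrancl)
  next
    case 2
    then show ?thesis using step by auto
  next
    case 3
    with step obtain w where w: "(w, x) \<in> {(u, v). (Inl v, Inl u) \<in> F}\<^sup>*" "(Inl w, Inr w) \<in> F"
        "(w, u) \<in> {(u, v). (Inr u, Inr v) \<in> F}\<^sup>*" by auto
    have "(u, v) \<in> {(u, v). (Inr u, Inr v) \<in> F}" using step 3 by simp
    with w(3) have "(w, v) \<in> {(u, v). (Inr u, Inr v) \<in> F}\<^sup>*" by (rule rtrancl.rtrancl_into_rtrancl)
    with w 3 show ?thesis by auto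
  qed
qed

text \<open>
  A separator \<open>C\<close> of the doubled graph yields the t-separating pair \<open>(Inl -` C, Inr -` C)\<close> of total size
  \<open>card C\<close>, so Menger's theorem provides \<open>k\<close> disjoint paths. The set \<open>U\<close> consists of the vertices at which
  they cross from the left to the right copy.
\<close>

theorem trek_systems_exist:
  fixes G :: "'v::finite rel"
  assumes "\<And>ZX ZY. t_separates G ZX ZY X Y \<Longrightarrow> k \<le> card ZX + card ZY"
  obtains U g g' FL FR where "card U = k" "path_system G U X g FL" "path_system G U Y g' FR"
proof -
  have "k \<le> card C" if "separates (trek_graph G) (Inl ` X) (Inr ` Y) C" for C
  proof -
    have "k \<le> card (Inl -` C :: 'v set) + card (Inr -` C :: 'v set)"
      using assms t_separates_of_separates[OF that] by blast
    also have "\<dots> = card ((Inl -` C :: 'v set) <+> (Inr -` C :: 'v set))" by (simp add: card_Plus)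
    also have "(Inl -` C) <+> (Inr -` C) = C"
    proof (rule set_eqI)
      show "c \<in> (Inl -` C) <+> (Inr -` C) \<longleftrightarrow> c \<in> C" for c by (cases c) auto
    qed
    finally show ?thesis .
  qed
  then obtain F S where L: "linking (trek_graph G) (Inl ` X) (Inr ` Y) F S" and card: "card S = k"
    using Menger[of "trek_graph G" "Inl ` X" "Inr ` Y" k] by auto
  have F: "F \<subseteq> trek_graph G" "single_valued F" "single_valued (F\<inverse>)" "S \<subseteq> Inl ` X"
      "S \<inter> Range F = {}" "\<forall>a\<in>S. \<exists>b\<in>Inr ` Y. (a, b) \<in> F\<^sup>*"
    using L unfolding linking_def by blast+
  define FL where "FL = {(u, v). (Inl v, Inl u) \<in> F}"
  define FR where "FR = {(u, v). (Inr u, Inr v) \<in> F}"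
  have "\<exists>x u y. a = Inl x \<and> x \<in> X \<and> y \<in> Y \<and> (u, x) \<in> FL\<^sup>* \<and> (Inl u, Inr u) \<in> F \<and> (u, y) \<in> FR\<^sup>*"
    if a: "a \<in> S" for a
  proof -
    obtain x where x: "a = Inl x" "x \<in> X" using a F(4) by blast
    obtain y where y: "y \<in> Y" "(a, Inr y) \<in> F\<^sup>*" using F(6) a by blast
    show ?thesis
      using crossing_vertex[OF F(1) y(2)[unfolded x(1)]] x y unfolding FL_def FR_def by auto
  qed
  then obtain src top tgt where st: "\<And>a. a \<in> S \<Longrightarrow> a = Inl (src a) \<and> src a \<in> X \<and> tgt a \<in> Y \<and>
      (top a, src a) \<in> FL\<^sup>* \<and> (Inl (top a), Inr (top a)) \<in> F \<and> (top a, tgt a) \<in> FR\<^sup>*"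
    by metis
  have FL_F: "(Inl v, Inl u) \<in> F\<^sup>*" if "(u, v) \<in> FL\<^sup>*" for u v
    using that
  proof (induction rule: rtrancl_induct)
    case (step v w)
    then have "(Inl w, Inl v) \<in> F" by (simp add: FL_def)
    then show ?case using step.IH by (rule converse_rtrancl_into_rtrancl)
  qed simp
  have inj: "inj_on top S"
  proof (rule inj_onI)
    fix a a' assume a: "a \<in> S" "a' \<in> S" "top a = top a'"
    then have "(a, Inl (top a)) \<in> F\<^sup>*" "(a', Inl (top a)) \<in> F\<^sup>*"
      using FL_F st by metis+
    then have "(Inl (top a), a) \<in> (F\<inverse>)\<^sup>*" "(Inl (top a), a') \<in> (F\<inverse>)\<^sup>*"
      by (auto intro: rtrancl_converseI)
    then show "a = a'"
      by (rule terminal_unique[OF F(3)]) (use a F(5) in auto)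
  qed
  define U where "U = top ` S"
  define i where "i = inv_into S top"
  have i: "i u \<in> S \<and> top (i u) = u" if "u \<in> U" for u
    using that by (simp add: U_def i_def inv_into_into f_inv_into_f)
  show ?thesis
  proof
    show "card U = k" using card_image[OF inj] card by (simp add: U_def)
    show "path_system G U X (src \<circ> i) FL"
    proof (rule path_systemI)
      show "FL \<subseteq> G" using F(1) by (auto simp: FL_def trek_graph_def)
      show "single_valued FL" "single_valued (FL\<inverse>)"
        using F(2,3) unfolding FL_def single_valued_def by blast+
      show "U \<inter> Range FL = {}"
        using st F(2) by (auto simp: U_def FL_def dest: single_valuedD)
      show "(src \<circ> i) u \<in> X \<and> (u, (src \<circ> i) u) \<in> FL\<^sup>*" if "u \<in> U" for u
        using i[OF that] st[of "i u"] by auto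
    qed
    show "path_system G U Y (tgt \<circ> i) FR"
    proof (rule path_systemI)
      show "FR \<subseteq> G" using F(1) by (auto simp: FR_def trek_graph_def)
      show "single_valued FR" "single_valued (FR\<inverse>)"
        using F(2,3) unfolding FR_def single_valued_def by blast+
      show "U \<inter> Range FR = {}"
      proof -
        have "u \<notin> Range FR" if u: "u \<in> U" for u
        proof
          assume "u \<in> Range FR"
          then obtain v where "(Inr v, Inr u) \<in> F" by (auto simp: FR_def)
          moreover have "(Inl u, Inr u) \<in> F" using i[OF u] st by metis
          ultimately show False using F(3) unfolding single_valued_def by blast
        qed
        then show ?thesis by blast
      qed
      show "(tgt \<circ> i) u \<in> Y \<and> (u, (tgt \<circ> i) u) \<in> FR\<^sup>*" if "u \<in> U" for u
        using i[OF that] st[of "i u"] by auto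
    qed
  qed
qed

section \<open>Rank of matrices over a field\<close>

lemma rank_le_card_sum:
  fixes M :: "'a::field ^'n ^'m"
  assumes "\<And>i. M $ i = (\<Sum>z\<in>Z. c i z *s b z) + (\<Sum>z\<in>Z'. c' i z *s b' z)"
    and "finite Z" "finite Z'"
  shows "rank M \<le> card Z + card Z'"
proof -
  have "rows M \<subseteq> vec.span (b ` Z \<union> b' ` Z')"
  proof
    fix v assume "v \<in> rows M"
    then obtain i where "v = M $ i" by (auto simp: rows_def row_def vec_lambda_eta)
    then have v: "v = (\<Sum>z\<in>Z. c i z *s b z) + (\<Sum>z\<in>Z'. c' i z *s b' z)" using assms(1) by simp
    show "v \<in> vec.span (b ` Z \<union> b' ` Z')"
      unfolding v
      by (intro vec.span_add vec.span_sum vec.span_scale vec.span_base) auto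
  qed
  then have "rank M \<le> card (b ` Z \<union> b' ` Z')"
    unfolding row_rank_def_gen using assms(2,3) by (intro vec.dim_le_card) auto
  also have "\<dots> \<le> card (b ` Z) + card (b' ` Z')" by (rule card_Un_le)
  also have "\<dots> \<le> card Z + card Z'" using assms(2,3) by (intro add_mono card_image_le)
  finally show ?thesis .
qed

text \<open>
  The square matrix with entries \<open>M $ g u $ g' w\<close> for \<open>u, w \<in> U\<close>, extended by an identity block to the
  whole index type: its determinant is the minor of \<open>M\<close> with rows \<open>g ` U\<close> and columns \<open>g' ` U\<close>, up to
  sign, and no type of cardinality \<open>card U\<close> has to be introduced.
\<close>

definition bordered_minor :: "'n set \<Rightarrow> ('n \<Rightarrow> 'm) \<Rightarrow> ('n \<Rightarrow> 'k) \<Rightarrow> 'a::zero_neq_one ^'k ^'m \<Rightarrow> 'a ^'n ^'n" where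
  "bordered_minor U g g' M =
     (\<chi> u w. if u \<in> U \<and> w \<in> U then M $ g u $ g' w else if u = w then 1 else 0)"

text \<open>
  The rows of the bordered matrix lie in the span of a linear image of the row space of \<open>M\<close> together with one
  unit vector for each index outside \<open>U\<close>. If the determinant is nonzero, they span everything, and counting
  dimensions gives the bound.
\<close>

lemma card_le_rank_if_minor_nonzero:
  fixes M :: "'a::field ^'k ^'m" and U :: "'n::finite set"
  assumes "det (bordered_minor U g g' M) \<noteq> 0"
  shows "card U \<le> rank M"
proof -
  let ?N = "bordered_minor U g g' M"
  obtain B where B: "B \<subseteq> rows M" "vec.independent B" "rows M \<subseteq> vec.span B" "card B = vec.dim (rows M)"
    using vec.basis_exists by blast
  have finB: "finite B" using B(2) by (rule vec.finiteI_independent)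
  define f :: "'a ^'k \<Rightarrow> 'a ^'n" where "f x = (\<chi> w. if w \<in> U then x $ g' w else 0)" for x
  interpret f: Vector_Spaces.linear "(*s)" "(*s)" f
    by standard (auto simp: f_def vec_eq_iff)
  have "rows ?N \<subseteq> vec.span (f ` B \<union> (\<lambda>u. axis u 1) ` (-U))"
  proof
    fix v assume "v \<in> rows ?N"
    then obtain u where u: "v = ?N $ u" by (auto simp: rows_def row_def vec_lambda_eta)
    show "v \<in> vec.span (f ` B \<union> (\<lambda>u. axis u 1) ` (-U))"
    proof (cases "u \<in> U")
      case True
      have "v = f (M $ g u)"
        using True by (auto simp: u f_def bordered_minor_def vec_eq_iff)
      moreover have "M $ g u \<in> vec.span B"
        using B(3) by (auto simp: rows_def row_def vec_lambda_eta)
      ultimately have "v \<in> vec.span (f ` B)" using f.span_image[of B] by blast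
      then show ?thesis using vec.span_mono[of "f ` B"] by blast
    next
      case False
      then have "v = axis u 1" by (auto simp: u bordered_minor_def vec_eq_iff axis_def)
      with False show ?thesis by (intro vec.span_base) auto
    qed
  qed
  moreover have "vec.span (rows ?N) = UNIV"
    using assms by (metis invertible_det_nz invertible_left_inverse matrix_left_invertible_span_rows_gen)
  ultimately have "UNIV \<subseteq> vec.span (f ` B \<union> (\<lambda>u. axis u 1) ` (-U))"
    by (metis vec.span_minimal vec.subspace_span)
  then have "vec.dim (UNIV :: ('a ^'n) set) \<le> card (f ` B \<union> (\<lambda>u. axis u 1) ` (-U))"
    by (rule vec.dim_le_card) (use finB in simp)
  also have "\<dots> \<le> card (f ` B) + card ((\<lambda>u. axis u 1 :: 'a ^'n) ` (-U))" by (rule card_Un_le)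
  also have "\<dots> \<le> card B + card (-U)" using finB by (intro add_mono card_image_le) auto
  finally have "CARD('n) \<le> card B + (CARD('n) - card U)"
    unfolding vec_dim_card by (simp add: Compl_eq_Diff_UNIV card_Diff_subset)
  moreover have "card U \<le> CARD('n)" by (simp add: card_mono)
  ultimately show ?thesis using B(4) by (simp add: row_rank_def_gen)
qed

section \<open>Factoring the spectrum through a separating pair\<close>

lemma matrix_diff_rdistrib:
  fixes M N :: "'a::ring_1 ^'n ^'m"
  shows "(M - N) ** B = M ** B - N ** B"
  by (simp add: matrix_matrix_mult_def vec_eq_iff left_diff_distrib sum_subtractf)

lemma mult_matrix_inv:
  fixes M :: "'a::semiring_1 ^'n ^'n"
  assumes "invertible M"
  shows "M ** matrix_inv M = mat 1" "matrix_inv M ** M = mat 1"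
  using someI_ex[OF assms[unfolded invertible_def]] unfolding matrix_inv_def by auto

lemma matrix_inv_eqI:
  fixes M :: "'a::field ^'n ^'n"
  assumes "M ** B = mat 1"
  shows "matrix_inv M = B"
proof -
  have "invertible M" using assms by (meson invertible_right_inverse)
  then have "matrix_inv M ** (M ** B) = B"
    by (simp add: matrix_mul_assoc mult_matrix_inv)
  with assms show ?thesis by simp
qed

lemma wf_converse_edges: "acyclic G \<Longrightarrow> wf (G\<inverse>)" for G :: "'v::finite rel"
  by (intro finite_acyclic_wf_converse) auto

context
  fixes G :: "'v::finite rel" and H :: "'a::field ^'v ^'v"
  assumes acyclic: "acyclic G" and supp: "\<And>u w. H $ u $ w \<noteq> 0 \<Longrightarrow> (u, w) \<in> G"
begin

text \<open>
  In an acyclic graph a vector with \<open>x = H *v x\<close> vanishes at the sinks and then, by induction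
  along the reversed edges, everywhere.
\<close>

lemma invertible_one_minus_supported: "invertible (mat 1 - H)"
proof -
  have "x = 0" if x: "(mat 1 - H) *v x = 0" for x
  proof -
    have eq: "x $ u = (\<Sum>w\<in>UNIV. H $ u $ w * x $ w)" for u
    proof -
      have "x - H *v x = 0" using x by (simp add: matrix_vector_mult_diff_rdistrib)
      then have "x $ u = (H *v x) $ u" by simp
      then show ?thesis by (simp add: matrix_vector_mult_def)
    qed
    have "x $ u = 0" for u
    proof (induction u rule: wf_induct_rule[OF wf_converse_edges[OF acyclic]])
      case (1 u)
      then have "H $ u $ w * x $ w = 0" for w using supp[of u w] by auto
      then show ?case by (subst eq) (simp only: sum.neutral_const)
    qed
    then show ?thesis by (simp add: vec_eq_iff)
  qed
  then show ?thesis
    using matrix_left_invertible_ker invertible_left_inverse by blast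
qed

text \<open>
  The path expansion of the inverse: a path from \<open>u\<close> to \<open>x\<close> is empty or begins with an edge from \<open>u\<close>. This
  recursion along the well-founded converse of the graph replaces sums over paths throughout.
\<close>

lemma inverse_one_minus_rec:
  "matrix_inv (mat 1 - H) $ u $ x =
     (if u = x then 1 else 0) + (\<Sum>w\<in>UNIV. H $ u $ w * matrix_inv (mat 1 - H) $ w $ x)"
proof -
  let ?A = "matrix_inv (mat 1 - H)"
  have "(mat 1 - H) ** ?A = mat 1"
    by (rule mult_matrix_inv[OF invertible_one_minus_supported])
  then have "?A = mat 1 + H ** ?A"
    by (simp add: matrix_diff_rdistrib algebra_simps)
  then have "?A $ u $ x = (mat 1 + H ** ?A) $ u $ x" by simp
  then show ?thesis by (simp add: matrix_matrix_mult_def mat_def)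
qed

end

lemma inverse_one_minus_avoiding_path:
  fixes G :: "'v::finite rel" and H :: "'a::field ^'v ^'v"
  assumes "acyclic G" and supp: "\<And>u w. H $ u $ w \<noteq> 0 \<Longrightarrow> (u, w) \<in> G \<and> w \<notin> Z"
    and "matrix_inv (mat 1 - H) $ u $ x \<noteq> 0" "u \<notin> Z"
  shows "\<exists>p. directed_path G u p x \<and> set p \<inter> Z = {}"
  using assms(3,4)
proof (induction u rule: wf_induct_rule[OF wf_converse_edges[OF assms(1)]])
  case (1 u)
  show ?case
  proof (cases "u = x")
    case True
    then have "directed_path G u [u] x" by (simp add: directed_path_def)
    with 1 show ?thesis by (intro exI[of _ "[u]"]) auto
  next
    case False
    define \<Sigma> where "\<Sigma> = (\<Sum>w\<in>UNIV. H $ u $ w * matrix_inv (mat 1 - H) $ w $ x)"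
    have "matrix_inv (mat 1 - H) $ u $ x = (if u = x then 1 else 0) + \<Sigma>"
      unfolding \<Sigma>_def using inverse_one_minus_rec[of G H u x, OF assms(1)] supp by blast
    then have "\<Sigma> \<noteq> 0" using False 1(2) by simp
    then obtain w where w: "H $ u $ w \<noteq> 0" "matrix_inv (mat 1 - H) $ w $ x \<noteq> 0"
      unfolding \<Sigma>_def by (metis (no_types, lifting) mult_eq_0_iff sum.neutral)
    then have "(u, w) \<in> G" "w \<notin> Z" using supp by auto
    then obtain p where p: "directed_path G w p x" "set p \<inter> Z = {}"
      using 1 w by blast
    with \<open>(u, w) \<in> G\<close> have "directed_path G u (u # p) x"
      by (cases p) (auto simp: directed_path_def successively_Cons)
    with p 1 show ?thesis by (intro exI[of _ "u # p"]) auto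
  qed
qed

text \<open>
  Decomposition of the paths from \<open>u\<close> to \<open>x\<close> according to \<open>Z\<close>: \<open>P\<close> collects those that avoid \<open>Z\<close>, and
  \<open>C u z\<close> collects the pieces that lead to a first vertex \<open>z \<in> Z\<close>.
\<close>

lemma inverse_one_minus_split:
  fixes G :: "'v::finite rel" and H :: "'a::field ^'v ^'v"
  assumes "acyclic G" and supp: "\<And>u w. H $ u $ w \<noteq> 0 \<Longrightarrow> (u, w) \<in> G"
  shows "\<exists>P C. (\<forall>u x. matrix_inv (mat 1 - H) $ u $ x =
        P u x + (\<Sum>z\<in>Z. C u z * matrix_inv (mat 1 - H) $ z $ x)) \<and>
      (\<forall>u x. P u x \<noteq> 0 \<longrightarrow> (\<exists>p. directed_path G u p x \<and> set p \<inter> Z = {}))"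
proof -
  let ?A = "matrix_inv (mat 1 - H)"
  \<comment> \<open>Without the edges into \<open>Z\<close>, a path that starts outside \<open>Z\<close> stays outside \<open>Z\<close>.\<close>
  define H0 where "H0 = (\<chi> u w. if w \<in> Z then 0 else H $ u $ w)"
  let ?B = "matrix_inv (mat 1 - H0)"
  have supp0: "H0 $ u $ w \<noteq> 0 \<Longrightarrow> (u, w) \<in> G \<and> w \<notin> Z" for u w
    using supp by (auto simp: H0_def split: if_splits)
  have "(mat 1 - H) ** ?A = mat 1"
    by (rule mult_matrix_inv[OF invertible_one_minus_supported[OF assms]])
  then have "(mat 1 - H0) ** ?A = mat 1 + (H - H0) ** ?A"
    by (simp add: matrix_diff_rdistrib algebra_simps)
  then have "?B ** ((mat 1 - H0) ** ?A) = ?B + ?B ** ((H - H0) ** ?A)"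
    by (simp add: matrix_add_ldistrib)
  then have split: "?A = ?B + (?B ** (H - H0)) ** ?A"
    using mult_matrix_inv(2)[OF invertible_one_minus_supported[OF assms(1), of H0]] supp0
    by (simp add: matrix_mul_assoc)
  have zero: "(?B ** (H - H0)) $ u $ z = 0" if "z \<notin> Z" for u z
    using that by (simp add: matrix_matrix_mult_def H0_def)
  define P where "P u x = (if u \<in> Z then 0 else ?B $ u $ x)" for u x
  \<comment> \<open>A path that starts in \<open>Z\<close> meets \<open>Z\<close> for the first time at its start.\<close>
  define C where "C u z = (if u \<in> Z then (if u = z then 1 else 0) else (?B ** (H - H0)) $ u $ z)" for u z
  show ?thesis
  proof (rule exI[of _ P], rule exI[of _ C], intro conjI allI impI)
    fix u x
    show "?A $ u $ x = P u x + (\<Sum>z\<in>Z. C u z * ?A $ z $ x)"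
    proof (cases "u \<in> Z")
      case True
      then show ?thesis by (simp add: P_def C_def if_distribR if_distrib cong: if_cong)
    next
      case False
      have "?A $ u $ x = (?B + (?B ** (H - H0)) ** ?A) $ u $ x" using split by simp
      also have "\<dots> = ?B $ u $ x + (\<Sum>z\<in>UNIV. (?B ** (H - H0)) $ u $ z * ?A $ z $ x)"
        by (subst (2) matrix_matrix_mult_def) simp
      also have "(\<Sum>z\<in>UNIV. (?B ** (H - H0)) $ u $ z * ?A $ z $ x) =
          (\<Sum>z\<in>Z. (?B ** (H - H0)) $ u $ z * ?A $ z $ x)"
        by (rule sum.mono_neutral_right) (auto simp: zero)
      finally show ?thesis using False by (simp add: P_def C_def)
    qed
    assume "P u x \<noteq> 0"
    then show "\<exists>p. directed_path G u p x \<and> set p \<inter> Z = {}"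
      using inverse_one_minus_avoiding_path[OF assms(1), of H0 Z u x] supp0
      by (auto simp: P_def split: if_splits)
  qed
qed

lemma sandwich_entry:
  fixes A B :: "'a::comm_semiring_1 ^'v ^'v"
  shows "(transpose A ** (\<chi> v w. if v = w then s v else 0) ** B) $ x $ y =
    (\<Sum>u\<in>UNIV. A $ u $ x * s u * B $ u $ y)"
proof -
  have eq: "transpose A ** (\<chi> v w. if v = w then s v else 0) = (\<chi> x u. A $ u $ x * s u)"
    by (simp add: vec_eq_iff matrix_matrix_mult_def transpose_def mult_delta_right)
  show ?thesis unfolding eq by (simp add: matrix_matrix_mult_def)
qed

text \<open>
  After splitting both inverses, the terms with \<open>P\<close> on the left and \<open>Q\<close> on the right vanish, because a
  nonzero one would give a trek that avoids \<open>ZX\<close> on its left and \<open>ZY\<close> on its right side. What is left is a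
  sum over \<open>ZX\<close> plus a sum over \<open>ZY\<close> of products of a column and a row.
\<close>

theorem rank_le_if_t_separates:
  fixes G :: "'v::finite rel" and H H' :: "'a::field ^'v ^'v"
  assumes "acyclic G" and supp: "\<And>u w. H $ u $ w \<noteq> 0 \<Longrightarrow> (u, w) \<in> G"
    and supp': "\<And>u w. H' $ u $ w \<noteq> 0 \<Longrightarrow> (u, w) \<in> G"
    and sep: "t_separates G ZX ZY X Y"
  shows "rank (submatrix_of (transpose (matrix_inv (mat 1 - H)) **
      (\<chi> v w. if v = w then s v else 0) ** matrix_inv (mat 1 - H')) X Y) \<le> card ZX + card ZY"
proof -
  let ?A = "matrix_inv (mat 1 - H)" and ?A' = "matrix_inv (mat 1 - H')"
  obtain P C where A: "\<forall>u x. ?A $ u $ x = P u x + (\<Sum>z\<in>ZX. C u z * ?A $ z $ x)"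
      and P: "\<forall>u x. P u x \<noteq> 0 \<longrightarrow> (\<exists>p. directed_path G u p x \<and> set p \<inter> ZX = {})"
    using inverse_one_minus_split[OF assms(1), of H ZX] supp by blast
  obtain Q C' where A': "\<forall>u x. ?A' $ u $ x = Q u x + (\<Sum>z\<in>ZY. C' u z * ?A' $ z $ x)"
      and Q: "\<forall>u x. Q u x \<noteq> 0 \<longrightarrow> (\<exists>p. directed_path G u p x \<and> set p \<inter> ZY = {})"
    using inverse_one_minus_split[OF assms(1), of H' ZY] supp' by blast
  have zero: "P u x * s u * Q u y = 0" if "x \<in> X" "y \<in> Y" for u x y
  proof (rule ccontr)
    assume "P u x * s u * Q u y \<noteq> 0"
    then have "P u x \<noteq> 0" "Q u y \<noteq> 0" by auto
    then obtain l r where "directed_path G u l x" "set l \<inter> ZX = {}"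
        "directed_path G u r y" "set r \<inter> ZY = {}"
      using P Q by blast
    with sep that show False by (auto simp: t_separates_def trek_def)
  qed
  define c where "c x z = (if x \<in> X then ?A $ z $ x else 0)" for x z
  define b where "b z = (\<chi> y. if y \<in> Y then \<Sum>u\<in>UNIV. C u z * s u * ?A' $ u $ y else 0)" for z
  define c' where "c' x z = (if x \<in> X then \<Sum>u\<in>UNIV. P u x * s u * C' u z else 0)" for x z
  define b' where "b' z = (\<chi> y. if y \<in> Y then ?A' $ z $ y else 0)" for z
  have entry: "(\<Sum>u\<in>UNIV. ?A $ u $ x * s u * ?A' $ u $ y) =
      (\<Sum>z\<in>ZX. ?A $ z $ x * (\<Sum>u\<in>UNIV. C u z * s u * ?A' $ u $ y)) +
      (\<Sum>z\<in>ZY. (\<Sum>u\<in>UNIV. P u x * s u * C' u z) * ?A' $ z $ y)"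
    if "x \<in> X" "y \<in> Y" for x y
  proof -
    have "?A $ u $ x * s u * ?A' $ u $ y =
        (\<Sum>z\<in>ZX. ?A $ z $ x * (C u z * s u * ?A' $ u $ y)) +
        (\<Sum>z\<in>ZY. P u x * s u * C' u z * ?A' $ z $ y)" for u
    proof -
      have "?A $ u $ x * s u * ?A' $ u $ y =
          (\<Sum>z\<in>ZX. C u z * ?A $ z $ x) * s u * ?A' $ u $ y + P u x * s u * ?A' $ u $ y"
        by (subst (1) A[rule_format]) (simp add: algebra_simps)
      also have "P u x * s u * ?A' $ u $ y = P u x * s u * (\<Sum>z\<in>ZY. C' u z * ?A' $ z $ y)"
        by (subst (1) A'[rule_format]) (simp add: distrib_left zero[OF that])
      finally show ?thesis by (simp add: sum_distrib_left sum_distrib_right mult_ac)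
    qed
    then have "(\<Sum>u\<in>UNIV. ?A $ u $ x * s u * ?A' $ u $ y) =
        (\<Sum>u\<in>UNIV. \<Sum>z\<in>ZX. ?A $ z $ x * (C u z * s u * ?A' $ u $ y)) +
        (\<Sum>u\<in>UNIV. \<Sum>z\<in>ZY. P u x * s u * C' u z * ?A' $ z $ y)"
      by (simp only: sum.distrib)
    also have "(\<Sum>u\<in>UNIV. \<Sum>z\<in>ZX. ?A $ z $ x * (C u z * s u * ?A' $ u $ y)) =
        (\<Sum>z\<in>ZX. ?A $ z $ x * (\<Sum>u\<in>UNIV. C u z * s u * ?A' $ u $ y))"
      by (subst sum.swap) (simp only: sum_distrib_left)
    also have "(\<Sum>u\<in>UNIV. \<Sum>z\<in>ZY. P u x * s u * C' u z * ?A' $ z $ y) =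
        (\<Sum>z\<in>ZY. (\<Sum>u\<in>UNIV. P u x * s u * C' u z) * ?A' $ z $ y)"
      by (subst sum.swap) (simp only: sum_distrib_right)
    finally show ?thesis .
  qed
  show ?thesis
  proof (rule rank_le_card_sum)
    fix x
    show "submatrix_of (transpose ?A ** (\<chi> v w. if v = w then s v else 0) ** ?A') X Y $ x =
        (\<Sum>z\<in>ZX. c x z *s b z) + (\<Sum>z\<in>ZY. c' x z *s b' z)"
    proof (rule vec_eq_iff[THEN iffD2], rule allI)
      fix y
      show "submatrix_of (transpose ?A ** (\<chi> v w. if v = w then s v else 0) ** ?A') X Y $ x $ y =
        ((\<Sum>z\<in>ZX. c x z *s b z) + (\<Sum>z\<in>ZY. c' x z *s b' z)) $ y"
        using entry[of x y]
        by (cases "x \<in> X"; cases "y \<in> Y")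
           (simp_all add: submatrix_of_def sandwich_entry c_def b_def c'_def b'_def)
    qed
  qed auto
qed

section \<open>Zero sets of polynomial functions\<close>

text \<open>
  Coordinates are indexed by an arbitrary type; each polynomial involves finitely many of them.
\<close>

inductive polyfun :: "(('i \<Rightarrow> real) \<Rightarrow> real) \<Rightarrow> bool" where
  const: "polyfun (\<lambda>_. c)"
| proj: "polyfun (\<lambda>x. x i)"
| add: "polyfun p \<Longrightarrow> polyfun q \<Longrightarrow> polyfun (\<lambda>x. p x + q x)"
| mult: "polyfun p \<Longrightarrow> polyfun q \<Longrightarrow> polyfun (\<lambda>x. p x * q x)"

lemma polyfun_compose:
  assumes "polyfun p" "\<And>i. polyfun (\<lambda>x. s x i)"
  shows "polyfun (\<lambda>x. p (s x))"
  using assms(1) by induction (auto intro: polyfun.intros assms(2))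

lemma polyfun_line:
  assumes "polyfun p"
  shows "\<exists>P. \<forall>t. p (\<lambda>i. a i + t * b i) = poly P t"
  using assms
proof induction
  case (const c)
  show ?case by (rule exI[of _ "[:c:]"]) simp
next
  case (proj i)
  show ?case by (rule exI[of _ "[:a i, b i:]"]) simp
next
  case (add p q)
  then show ?case by (metis poly_add)
next
  case (mult p q)
  then show ?case by (metis poly_mult)
qed

lemma polyfun_line_finite_zeros:
  assumes "polyfun p" "p (\<lambda>i. a i + t0 * b i) \<noteq> 0"
  shows "finite {t. p (\<lambda>i. a i + t * b i) = 0}"
proof -
  obtain P where P: "\<And>t. p (\<lambda>i. a i + t * b i) = poly P t"
    using polyfun_line[OF assms(1)] by metis
  with assms(2) have "P \<noteq> 0" by auto
  then show ?thesis unfolding P by (rule poly_roots_finite)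
qed

text \<open>
  A coordinate outside \<open>I\<close> has the constant value \<open>undefined\<close> on the product space.
\<close>

lemma measurable_polyfun:
  assumes "polyfun p"
  shows "p \<in> borel_measurable (PiM I (\<lambda>_. lborel))"
  using assms
proof induction
  case (proj i)
  show ?case
  proof (cases "i \<in> I")
    case True
    then have "(\<lambda>x. x i) \<in> measurable (PiM I (\<lambda>_. lborel)) lborel" by (rule measurable_component_singleton)
    then show ?thesis by simp
  next
    case False
    then have "x i = undefined" if "x \<in> space (PiM I (\<lambda>_. lborel))" for x :: "_ \<Rightarrow> real"
      using that by (auto simp: space_PiM PiE_def extensional_def)
    then show ?thesis by (subst measurable_cong[where g = "\<lambda>_. undefined"]) auto
  qed
qed auto

text \<open>
  Induction on the number of coordinates with Fubini's theorem. Freezing the coordinate \<open>i\<close> at \<open>x0 i\<close> leaves a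
  polynomial that is nonzero at \<open>x0\<close>, hence at almost every point \<open>x\<close> of the remaining coordinates. For
  such \<open>x\<close>, the polynomial in the coordinate \<open>i\<close> alone is not the zero polynomial and has finitely many
  roots.
\<close>

lemma AE_polyfun_nonzero:
  assumes "finite I" "polyfun p" "x0 \<in> extensional I" "p x0 \<noteq> 0"
  shows "AE x in PiM I (\<lambda>_. lborel). p x \<noteq> 0"
  using assms
proof (induction I arbitrary: p x0 rule: finite_induct)
  case empty
  then have "p x \<noteq> 0" if "x \<in> space (PiM {} (\<lambda>_. lborel))" for x :: "_ \<Rightarrow> real"
    using that by (auto simp: space_PiM)
  then show ?case by (intro AE_I2)
next
  case (insert i I)
  interpret product_sigma_finite "\<lambda>_::_. lborel :: real measure" ..
  let ?M = "\<lambda>I. PiM I (\<lambda>_. lborel :: real measure)"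
  have meas: "p \<in> borel_measurable (?M (insert i I))"
    using insert by (intro measurable_polyfun)
  have "polyfun (\<lambda>x. p (x(i := x0 i)))"
    using insert.prems(1)
  proof (rule polyfun_compose)
    show "polyfun (\<lambda>x. (x(i := x0 i)) j)" for j
      by (cases "j = i") (auto intro: polyfun.intros)
  qed
  moreover have "x0(i := undefined) \<in> extensional I"
    using insert by (auto simp: extensional_def)
  moreover have "p ((x0(i := undefined))(i := x0 i)) \<noteq> 0" using insert by simp
  ultimately have "AE x in ?M I. p (x(i := x0 i)) \<noteq> 0" by (rule insert.IH)
  then have slice: "AE x in ?M I. (\<integral>\<^sup>+ y. indicator {x. p x = 0} (x(i := y)) \<partial>lborel) = 0"
  proof eventually_elim
    case (elim x)
    \<comment> \<open>The slice in direction \<open>i\<close>, written as a line.\<close>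
    have upd: "x(i := y) = (\<lambda>j. (x(i := 0)) j + y * (if j = i then 1 else 0))" for y
      by (auto simp: fun_eq_iff)
    have "finite {y. p (\<lambda>j. (x(i := 0)) j + y * (if j = i then 1 else 0)) = 0}"
      by (rule polyfun_line_finite_zeros[OF insert.prems(1), where ?t0.0 = "x0 i"])
         (unfold upd[symmetric], rule elim)
    then have "finite {y. p (x(i := y)) = 0}" unfolding upd[symmetric] .
    then have "{y. p (x(i := y)) = 0} \<in> null_sets lborel" by (rule finite_imp_null_set_lborel)
    then have "emeasure lborel {y. p (x(i := y)) = 0} = 0" "{y. p (x(i := y)) = 0} \<in> sets lborel" by auto
    moreover have "(\<lambda>y. indicator {x. p x = 0} (x(i := y)) :: ennreal) = indicator {y. p (x(i := y)) = 0}"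
      by (auto simp: fun_eq_iff indicator_def)
    ultimately show ?case by simp
  qed
  let ?N = "{x \<in> space (?M (insert i I)). p x = 0}"
  have N: "?N \<in> sets (?M (insert i I))" using meas by measurable
  have "emeasure (?M (insert i I)) ?N = (\<integral>\<^sup>+ x. indicator ?N x \<partial>?M (insert i I))" using N by simp
  also have "\<dots> = (\<integral>\<^sup>+ x. indicator {x. p x = 0} x \<partial>?M (insert i I))"
    by (rule nn_integral_cong) (auto simp: indicator_def)
  also have "\<dots> = (\<integral>\<^sup>+ x. (\<integral>\<^sup>+ y. indicator {x. p x = 0} (x(i := y)) \<partial>lborel) \<partial>?M I)"
  proof (rule product_nn_integral_insert[OF insert.hyps(1,2)])
    show "indicator {x. p x = 0} \<in> borel_measurable (?M (insert i I))"
    proof -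
      have "(indicator {x. p x = 0} :: _ \<Rightarrow> ennreal) = (\<lambda>x. indicator {0} (p x))"
        by (auto simp: indicator_def)
      then show ?thesis using meas by simp
    qed
  qed
  also have "\<dots> = 0" using slice by (subst nn_integral_cong_AE[where v = "\<lambda>_. 0"]) auto
  finally show ?case using N by (intro AE_I[where N = ?N]) auto
qed

lemma measurable_polyfun_case_sum:
  assumes "polyfun p"
  shows "(\<lambda>(x, y). p (case_sum x y)) \<in> borel_measurable (PiM I (\<lambda>_. lborel) \<Otimes>\<^sub>M PiM J (\<lambda>_. lborel))"
  using assms
proof induction
  case (proj k)
  show ?case
  proof (cases k)
    case (Inl i)
    have "(\<lambda>z. fst z i :: real) \<in> borel_measurable (PiM I (\<lambda>_. lborel) \<Otimes>\<^sub>M PiM J (\<lambda>_. lborel))"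
      using measurable_compose[OF measurable_fst measurable_polyfun[OF polyfun.proj]] .
    then show ?thesis by (simp add: Inl case_prod_beta)
  next
    case (Inr i)
    have "(\<lambda>z. snd z i :: real) \<in> borel_measurable (PiM I (\<lambda>_. lborel) \<Otimes>\<^sub>M PiM J (\<lambda>_. lborel))"
      using measurable_compose[OF measurable_snd measurable_polyfun[OF polyfun.proj]] .
    then show ?thesis by (simp add: Inr case_prod_beta)
  qed
qed (auto simp: case_prod_beta)

text \<open>
  The parameters live in a product of two product spaces; sum-indexed coordinates describe both factors
  at once. The proof is the Fubini argument again, now with one step for each factor.
\<close>

lemma AE_polyfun_nonzero_pair:
  assumes fin: "finite I" "finite J" and p: "polyfun p"
    and x0: "x0 \<in> extensional I" and y0: "y0 \<in> extensional J" and nz: "p (case_sum x0 y0) \<noteq> 0"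
  shows "AE z in PiM I (\<lambda>_. lborel) \<Otimes>\<^sub>M PiM J (\<lambda>_. lborel). p (case_sum (fst z) (snd z)) \<noteq> 0"
proof -
  interpret I: finite_product_sigma_finite "\<lambda>_::_. lborel :: real measure" I
    by standard (rule fin)
  interpret J: finite_product_sigma_finite "\<lambda>_::_. lborel :: real measure" J
    by standard (rule fin)
  interpret pair_sigma_finite "PiM I (\<lambda>_. lborel :: real measure)" "PiM J (\<lambda>_. lborel :: real measure)" ..
  have left: "polyfun (\<lambda>x. p (case_sum x y))" and right: "polyfun (\<lambda>y. p (case_sum x y))" for x y
  proof -
    have cs: "polyfun (\<lambda>x. case_sum x y k)" "polyfun (\<lambda>y. case_sum x y k)" for k
      by (cases k; simp add: polyfun.intros)+
    show "polyfun (\<lambda>x. p (case_sum x y))" by (rule polyfun_compose[OF p cs(1)])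
    show "polyfun (\<lambda>y. p (case_sum x y))" by (rule polyfun_compose[OF p cs(2)])
  qed
  have "AE x in PiM I (\<lambda>_. lborel). p (case_sum x y0) \<noteq> 0"
    using AE_polyfun_nonzero[where p = "\<lambda>x. p (case_sum x y0)", OF fin(1) left x0 nz] .
  then have "AE x in PiM I (\<lambda>_. lborel). AE y in PiM J (\<lambda>_. lborel). p (case_sum x y) \<noteq> 0"
  proof eventually_elim
    case (elim x)
    show ?case using AE_polyfun_nonzero[where p = "\<lambda>y. p (case_sum x y)", OF fin(2) right y0 elim] .
  qed
  moreover have "{z \<in> space (PiM I (\<lambda>_. lborel) \<Otimes>\<^sub>M PiM J (\<lambda>_. lborel)). p (case_sum (fst z) (snd z)) \<noteq> 0}
      \<in> sets (PiM I (\<lambda>_. lborel) \<Otimes>\<^sub>M PiM J (\<lambda>_. lborel))"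
    using measurable_polyfun_case_sum[OF p, of I J] by (simp add: case_prod_beta)
  ultimately show ?thesis by (subst AE_pair_iff[symmetric]) auto
qed

section \<open>Evaluation of rational functions at z = 1\<close>

text \<open>
  A relation instead of a function, so that \<open>value_at_1 q c\<close> includes the regularity of \<open>q\<close> at \<open>1\<close>.
\<close>

definition value_at_1 :: "real poly fract \<Rightarrow> real \<Rightarrow> bool" where
  "value_at_1 q c \<longleftrightarrow> (\<exists>a b. q = Fract a b \<and> poly b 1 \<noteq> 0 \<and> c = poly a 1 / poly b 1)"

lemma value_at_1_Fract: "poly b 1 \<noteq> 0 \<Longrightarrow> value_at_1 (Fract a b) (poly a 1 / poly b 1)"
  unfolding value_at_1_def by blast

lemma value_at_1_to_fract: "value_at_1 (to_fract p) (poly p 1)"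
  using value_at_1_Fract[of 1 p] by (simp add: to_fract_def)

lemma value_at_1_const: "value_at_1 (ratfun_const c) c"
  using value_at_1_to_fract[of "[:c:]"] by simp

lemma value_at_1_0: "value_at_1 0 0" and value_at_1_1: "value_at_1 1 1"
  using value_at_1_to_fract[of 0] value_at_1_to_fract[of 1] by simp_all

lemma value_at_1_nonzero:
  assumes "value_at_1 q c" "c \<noteq> 0"
  shows "q \<noteq> 0"
proof
  assume "q = 0"
  then obtain a b where "Fract a b = 0" "poly b 1 \<noteq> 0" "c = poly a 1 / poly b 1"
    using assms(1) by (auto simp: value_at_1_def)
  moreover from this have "b \<noteq> 0" by auto
  with \<open>Fract a b = 0\<close> have "a = 0" by (simp add: Zero_fract_def eq_fract)
  ultimately show False using assms(2) by simp
qed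

lemma value_at_1_add:
  assumes "value_at_1 q c" "value_at_1 q' c'"
  shows "value_at_1 (q + q') (c + c')"
proof -
  obtain a b a' b' where "q = Fract a b" "poly b 1 \<noteq> 0" "c = poly a 1 / poly b 1"
      "q' = Fract a' b'" "poly b' 1 \<noteq> 0" "c' = poly a' 1 / poly b' 1"
    using assms unfolding value_at_1_def by blast
  moreover from this have "b \<noteq> 0" "b' \<noteq> 0" by auto
  ultimately show ?thesis
    using value_at_1_Fract[of "b * b'" "a * b' + a' * b"] by (simp add: add_frac_eq)
qed

lemma value_at_1_mult:
  assumes "value_at_1 q c" "value_at_1 q' c'"
  shows "value_at_1 (q * q') (c * c')"
proof -
  obtain a b a' b' where "q = Fract a b" "poly b 1 \<noteq> 0" "c = poly a 1 / poly b 1"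
      "q' = Fract a' b'" "poly b' 1 \<noteq> 0" "c' = poly a' 1 / poly b' 1"
    using assms unfolding value_at_1_def by blast
  then show ?thesis using value_at_1_Fract[of "b * b'" "a * a'"] by simp
qed

lemma value_at_1_inverse:
  assumes "value_at_1 q c" "c \<noteq> 0"
  shows "value_at_1 (inverse q) (inverse c)"
proof -
  obtain a b where "q = Fract a b" "poly b 1 \<noteq> 0" "c = poly a 1 / poly b 1"
    using assms unfolding value_at_1_def by blast
  with assms(2) show ?thesis using value_at_1_Fract[of a b] by simp
qed

lemma value_at_1_diff: "value_at_1 q c \<Longrightarrow> value_at_1 q' c' \<Longrightarrow> value_at_1 (q - q') (c - c')"
  using value_at_1_add[of q c "- 1 * q'" "- 1 * c'"]
    value_at_1_mult[of "- 1" "- 1" q' c'] value_at_1_to_fract[of "- 1"]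
  by simp

lemma value_at_1_divide:
  "value_at_1 q c \<Longrightarrow> value_at_1 q' c' \<Longrightarrow> c' \<noteq> 0 \<Longrightarrow> value_at_1 (q / q') (c / c')"
  unfolding divide_inverse by (intro value_at_1_mult value_at_1_inverse)

lemma value_at_1_sum:
  "(\<And>i. i \<in> I \<Longrightarrow> value_at_1 (f i) (g i)) \<Longrightarrow> value_at_1 (sum f I) (sum g I)"
  by (induction I rule: infinite_finite_induct) (auto intro: value_at_1_0 value_at_1_add)

lemma value_at_1_prod:
  "(\<And>i. i \<in> I \<Longrightarrow> value_at_1 (f i) (g i)) \<Longrightarrow> value_at_1 (prod f I) (prod g I)"
  by (induction I rule: infinite_finite_induct) (auto intro: value_at_1_1 value_at_1_mult)

lemma value_at_1_det:
  assumes "\<And>i j. value_at_1 (M $ i $ j) (N $ i $ j)"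
  shows "value_at_1 (det M) (det N)"
proof -
  have "value_at_1 (of_int (sign p)) (of_int (sign p))" for p :: "'a \<Rightarrow> 'a"
    using value_at_1_1 value_at_1_diff[OF value_at_1_0 value_at_1_1]
    by (cases p rule: sign_cases) simp_all
  then show ?thesis
    unfolding det_def by (intro value_at_1_sum value_at_1_mult value_at_1_prod assms)
qed

lemma value_at_1_poly_at_inverse_z: "value_at_1 (poly_at_inverse_z p) (poly p 1)"
proof (induction p)
  case 0
  show ?case by (simp add: poly_at_inverse_z_def value_at_1_0)
next
  case (pCons a p)
  have "value_at_1 (inverse ratfun_z) (inverse 1)"
    using value_at_1_inverse[OF value_at_1_to_fract[of "[:0, 1:]"]] by simp
  then have "value_at_1 (ratfun_const a + inverse ratfun_z * poly_at_inverse_z p) (a + inverse 1 * poly p 1)"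
    by (intro value_at_1_add value_at_1_mult value_at_1_const pCons.IH)
  then show ?case by (simp add: poly_at_inverse_z_def map_poly_pCons)
qed

text \<open>
  The point \<open>1\<close> is its own inverse, so substituting \<open>1/z\<close> for \<open>z\<close> does not change the value there.
\<close>

lemma value_at_1_star:
  assumes "value_at_1 q c"
  shows "value_at_1 (ratfun_star q) c"
proof -
  obtain a b where ab: "q = Fract a b" "poly b 1 \<noteq> 0" "c = poly a 1 / poly b 1"
    using assms unfolding value_at_1_def by blast
  then have "b \<noteq> 0" by auto
  then have "ratfun_star q = poly_at_inverse_z a / poly_at_inverse_z b"
    unfolding ab(1) by (rule ratfun_star_Fract)
  then show ?thesis
    using ab value_at_1_divide[OF value_at_1_poly_at_inverse_z value_at_1_poly_at_inverse_z] by simp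
qed

lemma ratfun_star_0: "ratfun_star 0 = 0"
  using ratfun_star_Fract[of 1 0] by (simp add: Zero_fract_def[symmetric] poly_at_inverse_z_def)

lemma value_at_1_inverse_one_minus:
  fixes G :: "'v::finite rel"
  assumes G: "acyclic G" and H: "\<And>u w. H $ u $ w \<noteq> 0 \<Longrightarrow> (u, w) \<in> G"
    and h: "\<And>u w. h $ u $ w \<noteq> 0 \<Longrightarrow> (u, w) \<in> G" and Hh: "\<And>u w. value_at_1 (H $ u $ w) (h $ u $ w)"
  shows "value_at_1 (matrix_inv (mat 1 - H) $ u $ x) (matrix_inv (mat 1 - h) $ u $ x)"
proof (induction u rule: wf_induct_rule[OF wf_converse_edges[OF G]])
  case (1 u)
  have "value_at_1 (H $ u $ w * matrix_inv (mat 1 - H) $ w $ x) (h $ u $ w * matrix_inv (mat 1 - h) $ w $ x)" for w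
  proof (cases "(u, w) \<in> G")
    case True
    then show ?thesis using 1 by (intro value_at_1_mult Hh) auto
  next
    case False
    then have "H $ u $ w = 0" "h $ u $ w = 0" using H h by blast+
    then show ?thesis by (simp add: value_at_1_0)
  qed
  then have "value_at_1
      ((if u = x then 1 else 0) + (\<Sum>w\<in>UNIV. H $ u $ w * matrix_inv (mat 1 - H) $ w $ x))
      ((if u = x then 1 else 0) + (\<Sum>w\<in>UNIV. h $ u $ w * matrix_inv (mat 1 - h) $ w $ x))"
    by (intro value_at_1_add value_at_1_sum) (simp_all add: value_at_1_0 value_at_1_1)
  moreover have "matrix_inv (mat 1 - H) $ u $ x =
      (if u = x then 1 else 0) + (\<Sum>w\<in>UNIV. H $ u $ w * matrix_inv (mat 1 - H) $ w $ x)"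
    using inverse_one_minus_rec[of G H u x, OF G] H by blast
  moreover have "matrix_inv (mat 1 - h) $ u $ x =
      (if u = x then 1 else 0) + (\<Sum>w\<in>UNIV. h $ u $ w * matrix_inv (mat 1 - h) $ w $ x)"
    using inverse_one_minus_rec[of G h u x, OF G] h by blast
  ultimately show ?case by metis
qed

definition lag_sum :: "'v tsgraph \<Rightarrow> ('v \<times> 'v \<times> nat \<Rightarrow> real) \<Rightarrow> 'v \<Rightarrow> 'v \<Rightarrow> real" where
  "lag_sum E \<Phi> v w = (\<Sum>k | lag_edge E v w k. \<Phi> (v, w, k))"

definition transfer_at_1 :: "'v::finite tsgraph \<Rightarrow> ('v \<times> 'v \<times> nat \<Rightarrow> real) \<Rightarrow> real ^'v ^'v" where
  "transfer_at_1 E \<Phi> = (\<chi> v w. if (v, w) \<in> process_graph E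
     then lag_sum E \<Phi> v w / (1 - lag_sum E \<Phi> w w) else 0)"

definition spectrum_at_1 ::
    "'v::finite tsgraph \<Rightarrow> ('v \<times> 'v \<times> nat \<Rightarrow> real) \<Rightarrow> ('v \<Rightarrow> real) \<Rightarrow> real ^'v ^'v" where
  "spectrum_at_1 E \<Phi> \<omega> = (\<chi> x y. \<Sum>u\<in>UNIV. matrix_inv (mat 1 - transfer_at_1 E \<Phi>) $ u $ x *
     (\<omega> u * inverse (1 - lag_sum E \<Phi> u u) * inverse (1 - lag_sum E \<Phi> u u)) *
     matrix_inv (mat 1 - transfer_at_1 E \<Phi>) $ u $ y)"

lemma lag_sum_neq_1_if_stable:
  assumes "\<Phi> \<in> stable_coeffs E"
  shows "lag_sum E \<Phi> v v \<noteq> 1"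
proof -
  have "\<bar>lag_sum E \<Phi> v v\<bar> \<le> (\<Sum>k | lag_edge E v v k. \<bar>\<Phi> (v, v, k)\<bar>)"
    unfolding lag_sum_def by (rule sum_abs)
  also have "\<dots> < 1" using assms by (simp add: stable_coeffs_def)
  finally show ?thesis by auto
qed

lemma value_at_1_lag_poly: "value_at_1 (lag_poly E \<Phi> v w) (lag_sum E \<Phi> v w)"
proof -
  have "value_at_1 (ratfun_z ^ k) 1" for k
  proof (induction k)
    case (Suc k)
    then show ?case using value_at_1_mult[OF value_at_1_to_fract[of "[:0, 1:]"] Suc] by simp
  qed (simp add: value_at_1_1)
  then have "value_at_1 (ratfun_const (\<Phi> (v, w, k)) * ratfun_z ^ k) (\<Phi> (v, w, k))" for k
    using value_at_1_mult[OF value_at_1_const[of "\<Phi> (v, w, k)"]] by fastforce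
  then show ?thesis unfolding lag_poly_def lag_sum_def by (intro value_at_1_sum)
qed

text \<open>
  Stability bounds \<open>lag_sum E \<Phi> v v\<close> by \<open>1\<close> in absolute value, so no denominator vanishes at \<open>z = 1\<close>.
\<close>

lemma value_at_1_spectrum:
  fixes E :: "'v::finite tsgraph"
  assumes G: "acyclic (process_graph E)" and \<Phi>: "\<Phi> \<in> stable_coeffs E"
  shows "value_at_1 (spectrum E \<Phi> \<omega> $ x $ y) (spectrum_at_1 E \<Phi> \<omega> $ x $ y)"
proof -
  let ?H = "transfer_function E \<Phi>" and ?h = "transfer_at_1 E \<Phi>"
  let ?Hs = "map_matrix ratfun_star ?H"
  have den: "1 - lag_sum E \<Phi> v v \<noteq> 0" for v
    using lag_sum_neq_1_if_stable[OF \<Phi>] by simp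
  have "value_at_1 (1 - lag_poly E \<Phi> v v) (1 - lag_sum E \<Phi> v v)" for v
    by (intro value_at_1_diff value_at_1_1 value_at_1_lag_poly)
  note gain = this value_at_1_inverse[OF this den]
  have H: "value_at_1 (?H $ u $ w) (?h $ u $ w)" for u w
    using value_at_1_divide[OF value_at_1_lag_poly[of E \<Phi> u w] gain(1)[of w] den[of w]] value_at_1_0
    by (simp add: transfer_function_def transfer_at_1_def)
  have Hs: "value_at_1 (?Hs $ u $ w) (?h $ u $ w)" for u w
    using value_at_1_star[OF H] by (simp add: map_matrix_def)
  have supp: "?H $ u $ w \<noteq> 0 \<Longrightarrow> (u, w) \<in> process_graph E"
      "?Hs $ u $ w \<noteq> 0 \<Longrightarrow> (u, w) \<in> process_graph E"
      "?h $ u $ w \<noteq> 0 \<Longrightarrow> (u, w) \<in> process_graph E" for u w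
    by (auto simp: transfer_function_def transfer_at_1_def map_matrix_def ratfun_star_0 split: if_splits)
  have "spectrum E \<Phi> \<omega> $ x $ y = (\<Sum>u\<in>UNIV. matrix_inv (mat 1 - ?H) $ u $ x *
      (ratfun_const (\<omega> u) * inverse (1 - lag_poly E \<Phi> u u) * ratfun_star (inverse (1 - lag_poly E \<Phi> u u))) *
      matrix_inv (mat 1 - ?Hs) $ u $ y)"
    unfolding spectrum_def internal_spectrum_def by (rule sandwich_entry)
  moreover have "value_at_1 \<dots> (spectrum_at_1 E \<Phi> \<omega> $ x $ y)"
    unfolding spectrum_at_1_def vec_lambda_beta
    by (intro value_at_1_sum value_at_1_mult value_at_1_const gain value_at_1_star[OF gain(2)]
          value_at_1_inverse_one_minus[OF G supp(1) supp(3) H]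
          value_at_1_inverse_one_minus[OF G supp(2) supp(3) Hs])
  ultimately show ?thesis by simp
qed

theorem card_le_spectrum_rank:
  fixes E :: "'v::finite tsgraph"
  assumes "acyclic (process_graph E)" "\<Phi> \<in> stable_coeffs E" "g ` U \<subseteq> X" "g' ` U \<subseteq> Y"
    and "det (bordered_minor U g g' (spectrum_at_1 E \<Phi> \<omega>)) \<noteq> 0"
  shows "card U \<le> spectrum_rank E \<Phi> \<omega> X Y"
  unfolding spectrum_rank_def
proof (rule card_le_rank_if_minor_nonzero)
  have eq: "bordered_minor U g g' (submatrix_of (spectrum E \<Phi> \<omega>) X Y) = bordered_minor U g g' (spectrum E \<Phi> \<omega>)"
    using assms(3,4) by (auto simp: bordered_minor_def submatrix_of_def vec_eq_iff)
  have "value_at_1 (det (bordered_minor U g g' (spectrum E \<Phi> \<omega>)))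
      (det (bordered_minor U g g' (spectrum_at_1 E \<Phi> \<omega>)))"
    by (intro value_at_1_det)
       (simp add: bordered_minor_def value_at_1_spectrum[OF assms(1,2)] value_at_1_0 value_at_1_1)
  then show "det (bordered_minor U g g' (submatrix_of (spectrum E \<Phi> \<omega>) X Y)) \<noteq> 0"
    unfolding eq by (rule value_at_1_nonzero) fact
qed

section \<open>Rational functions without poles on a set\<close>

definition ratfun_on :: "('i \<Rightarrow> real) set \<Rightarrow> (('i \<Rightarrow> real) \<Rightarrow> real) \<Rightarrow> bool" where
  "ratfun_on D q \<longleftrightarrow> (\<exists>p d. polyfun p \<and> polyfun d \<and> (\<forall>x\<in>D. d x \<noteq> 0 \<and> q x = p x / d x))"

lemma ratfun_onI:
  "polyfun p \<Longrightarrow> polyfun d \<Longrightarrow> (\<And>x. x \<in> D \<Longrightarrow> d x \<noteq> 0) \<Longrightarrow>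
    (\<And>x. x \<in> D \<Longrightarrow> q x = p x / d x) \<Longrightarrow> ratfun_on D q"
  unfolding ratfun_on_def by blast

lemma ratfun_onE:
  assumes "ratfun_on D q"
  obtains p d where "polyfun p" "polyfun d" "\<forall>x\<in>D. d x \<noteq> 0 \<and> q x = p x / d x"
  using assms unfolding ratfun_on_def by blast

lemma ratfun_on_polyfun: "polyfun p \<Longrightarrow> ratfun_on D p"
  by (rule ratfun_onI[of p "\<lambda>_. 1"]) (simp_all add: polyfun.const)

lemma ratfun_on_const: "ratfun_on D (\<lambda>_. c)" and ratfun_on_proj: "ratfun_on D (\<lambda>x. x i)"
  by (intro ratfun_on_polyfun polyfun.intros)+

lemma ratfun_on_add:
  assumes "ratfun_on D q" "ratfun_on D q'"
  shows "ratfun_on D (\<lambda>x. q x + q' x)"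
proof -
  from assms(1) obtain p d where pd: "polyfun p" "polyfun d"
      "\<forall>x\<in>D. d x \<noteq> 0 \<and> q x = p x / d x" by (rule ratfun_onE)
  from assms(2) obtain p' d' where pd': "polyfun p'" "polyfun d'"
      "\<forall>x\<in>D. d' x \<noteq> 0 \<and> q' x = p' x / d' x" by (rule ratfun_onE)
  show ?thesis
    by (rule ratfun_onI[of "\<lambda>x. p x * d' x + p' x * d x" "\<lambda>x. d x * d' x"])
       (simp_all add: pd pd' polyfun.add polyfun.mult add_frac_eq)
qed

lemma ratfun_on_mult:
  assumes "ratfun_on D q" "ratfun_on D q'"
  shows "ratfun_on D (\<lambda>x. q x * q' x)"
proof -
  from assms(1) obtain p d where pd: "polyfun p" "polyfun d"
      "\<forall>x\<in>D. d x \<noteq> 0 \<and> q x = p x / d x" by (rule ratfun_onE)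
  from assms(2) obtain p' d' where pd': "polyfun p'" "polyfun d'"
      "\<forall>x\<in>D. d' x \<noteq> 0 \<and> q' x = p' x / d' x" by (rule ratfun_onE)
  show ?thesis
    by (rule ratfun_onI[of "\<lambda>x. p x * p' x" "\<lambda>x. d x * d' x"]) (simp_all add: pd pd' polyfun.mult)
qed

lemma ratfun_on_inverse:
  assumes "ratfun_on D q" "\<And>x. x \<in> D \<Longrightarrow> q x \<noteq> 0"
  shows "ratfun_on D (\<lambda>x. inverse (q x))"
proof -
  from assms(1) obtain p d where pd: "polyfun p" "polyfun d"
      "\<forall>x\<in>D. d x \<noteq> 0 \<and> q x = p x / d x" by (rule ratfun_onE)
  have "p x \<noteq> 0" if "x \<in> D" for x using pd(3) assms(2)[OF that] that by auto
  with pd show ?thesis by (intro ratfun_onI[of d p]) simp_all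
qed

lemma ratfun_on_sum: "(\<And>i. i \<in> I \<Longrightarrow> ratfun_on D (f i)) \<Longrightarrow> ratfun_on D (\<lambda>x. \<Sum>i\<in>I. f i x)"
  by (induction I rule: infinite_finite_induct)
     (auto intro: ratfun_on_add ratfun_on_const)

lemma ratfun_on_prod: "(\<And>i. i \<in> I \<Longrightarrow> ratfun_on D (f i)) \<Longrightarrow> ratfun_on D (\<lambda>x. \<Prod>i\<in>I. f i x)"
  by (induction I rule: infinite_finite_induct)
     (auto intro: ratfun_on_mult ratfun_on_const)

lemma ratfun_on_cong: "ratfun_on D q \<Longrightarrow> (\<And>x. x \<in> D \<Longrightarrow> q x = q' x) \<Longrightarrow> ratfun_on D q'"
  unfolding ratfun_on_def by metis

lemma ratfun_on_det:
  assumes "\<And>i j. ratfun_on D (\<lambda>x. M x $ i $ j)"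
  shows "ratfun_on D (\<lambda>x. det (M x))"
  unfolding det_def
  by (intro ratfun_on_sum ratfun_on_mult ratfun_on_prod assms ratfun_on_const)

lemma ratfun_on_bordered_minor:
  assumes "\<And>i j. ratfun_on D (\<lambda>x. M x $ i $ j)"
  shows "ratfun_on D (\<lambda>x. det (bordered_minor U g g' (M x)))"
proof (rule ratfun_on_det)
  fix i j
  show "ratfun_on D (\<lambda>x. bordered_minor U g g' (M x) $ i $ j)"
    using assms by (cases "i \<in> U \<and> j \<in> U") (auto simp: bordered_minor_def ratfun_on_const)
qed

text \<open>
  On the line the numerators of both functions are univariate polynomials that are not identically
  zero, so together they have finitely many roots.
\<close>

lemma ratfun_on_common_nonzero:
  assumes "ratfun_on D q" "ratfun_on D q'"
    and line: "\<And>t. (\<lambda>i. a i + t * b i) \<in> D"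
    and "q (\<lambda>i. a i + t0 * b i) \<noteq> 0" "q' (\<lambda>i. a i + t1 * b i) \<noteq> 0"
  shows "\<exists>t. q (\<lambda>i. a i + t * b i) \<noteq> 0 \<and> q' (\<lambda>i. a i + t * b i) \<noteq> 0"
proof -
  let ?l = "\<lambda>t i. a i + t * b i"
  from assms(1) obtain p d where pd: "polyfun p" "polyfun d"
      "\<forall>x\<in>D. d x \<noteq> 0 \<and> q x = p x / d x" by (rule ratfun_onE)
  from assms(2) obtain p' d' where pd': "polyfun p'" "polyfun d'"
      "\<forall>x\<in>D. d' x \<noteq> 0 \<and> q' x = p' x / d' x" by (rule ratfun_onE)
  have zero: "q (?l t) = 0 \<longleftrightarrow> p (?l t) = 0" "q' (?l t) = 0 \<longleftrightarrow> p' (?l t) = 0" for t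
    using bspec[OF pd(3) line[of t]] bspec[OF pd'(3) line[of t]] by simp_all
  have "finite ({t. p (?l t) = 0} \<union> {t. p' (?l t) = 0})"
    using polyfun_line_finite_zeros[OF pd(1), of a t0 b] polyfun_line_finite_zeros[OF pd'(1), of a t1 b]
      assms(4,5) zero by simp
  then have "{t. p (?l t) = 0} \<union> {t. p' (?l t) = 0} \<noteq> UNIV"
    using infinite_UNIV_char_0 by metis
  then obtain t where "p (?l t) \<noteq> 0" "p' (?l t) \<noteq> 0" by blast
  then show ?thesis using zero by blast
qed

section \<open>The evaluated spectrum as a function of the parameters\<close>

type_synonym 'v param = "('v \<times> 'v \<times> nat) + 'v \<Rightarrow> real"

text \<open>
  The parameters for which the transfer function has no pole at \<open>z = 1\<close>. The set contains all stable
  parameters and also the parameters with edge weights \<open>0\<close> and \<open>1\<close> that select a path system; the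
  latter are not stable in general.
\<close>

definition regular_params :: "'v::finite tsgraph \<Rightarrow> 'v param set" where
  "regular_params E = {\<theta>. \<forall>w. lag_sum E (\<lambda>i. \<theta> (Inl i)) w w \<noteq> 1}"

lemma ratfun_on_lag_sum: "ratfun_on D (\<lambda>\<theta>. lag_sum E (\<lambda>i. \<theta> (Inl i)) v w)"
  unfolding lag_sum_def by (intro ratfun_on_sum ratfun_on_proj)

lemma ratfun_on_gain:
  "ratfun_on (regular_params E) (\<lambda>\<theta>. inverse (1 - lag_sum E (\<lambda>i. \<theta> (Inl i)) w w))"
proof (rule ratfun_on_inverse)
  have "ratfun_on (regular_params E) (\<lambda>\<theta>. 1 + (- 1) * lag_sum E (\<lambda>i. \<theta> (Inl i)) w w)"
    by (intro ratfun_on_add ratfun_on_mult ratfun_on_lag_sum ratfun_on_const)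
  then show "ratfun_on (regular_params E) (\<lambda>\<theta>. 1 - lag_sum E (\<lambda>i. \<theta> (Inl i)) w w)" by simp
  show "1 - lag_sum E (\<lambda>i. \<theta> (Inl i)) w w \<noteq> 0" if "\<theta> \<in> regular_params E" for \<theta>
    using that by (simp add: regular_params_def)
qed

lemma transfer_at_1_supported: "transfer_at_1 E \<Phi> $ u $ w \<noteq> 0 \<Longrightarrow> (u, w) \<in> process_graph E"
  by (auto simp: transfer_at_1_def split: if_splits)

lemma ratfun_on_path_gain:
  fixes E :: "'v::finite tsgraph"
  assumes G: "acyclic (process_graph E)"
  shows "ratfun_on (regular_params E) (\<lambda>\<theta>. matrix_inv (mat 1 - transfer_at_1 E (\<lambda>i. \<theta> (Inl i))) $ u $ x)"
proof (induction u rule: wf_induct_rule[OF wf_converse_edges[OF G]])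
  case (1 u)
  let ?A = "\<lambda>\<theta>. matrix_inv (mat 1 - transfer_at_1 E (\<lambda>i. \<theta> (Inl i)))"
  have "ratfun_on (regular_params E) (\<lambda>\<theta>. transfer_at_1 E (\<lambda>i. \<theta> (Inl i)) $ u $ w * ?A \<theta> $ w $ x)" for w
  proof (cases "(u, w) \<in> process_graph E")
    case True
    then have "ratfun_on (regular_params E) (\<lambda>\<theta>. ?A \<theta> $ w $ x)" using 1 by simp
    with True show ?thesis
      by (simp add: transfer_at_1_def divide_inverse)
         (intro ratfun_on_mult ratfun_on_lag_sum ratfun_on_gain)
  next
    case False
    then show ?thesis by (simp add: transfer_at_1_def ratfun_on_const)
  qed
  then have "ratfun_on (regular_params E)
      (\<lambda>\<theta>. (if u = x then 1 else 0) + (\<Sum>w\<in>UNIV. transfer_at_1 E (\<lambda>i. \<theta> (Inl i)) $ u $ w * ?A \<theta> $ w $ x))"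
    by (intro ratfun_on_add ratfun_on_sum ratfun_on_const)
  moreover have "(if u = x then 1 else 0) + (\<Sum>w\<in>UNIV. transfer_at_1 E (\<lambda>i. \<theta> (Inl i)) $ u $ w * ?A \<theta> $ w $ x) =
      ?A \<theta> $ u $ x" for \<theta>
    by (rule inverse_one_minus_rec[OF G transfer_at_1_supported, symmetric])
  ultimately show ?case by (rule ratfun_on_cong)
qed

lemma ratfun_on_spectrum_at_1:
  fixes E :: "'v::finite tsgraph"
  assumes "acyclic (process_graph E)"
  shows "ratfun_on (regular_params E) (\<lambda>\<theta>. spectrum_at_1 E (\<lambda>i. \<theta> (Inl i)) (\<lambda>i. \<theta> (Inr i)) $ x $ y)"
  unfolding spectrum_at_1_def vec_lambda_beta
  by (intro ratfun_on_sum ratfun_on_mult ratfun_on_path_gain[OF assms] ratfun_on_gain ratfun_on_proj)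

section \<open>A nonsingular minor from a system of treks\<close>

text \<open>
  For a subset \<open>F\<close> of the process graph, coefficients that make the evaluated transfer function the
  indicator of \<open>F\<close>: for each edge in \<open>F\<close> a single lag gets weight \<open>1\<close>. Outside the index set the
  value is \<open>undefined\<close>, as for every extensional family.
\<close>

definition edge_coeffs :: "'v tsgraph \<Rightarrow> 'v rel \<Rightarrow> 'v \<times> 'v \<times> nat \<Rightarrow> real" where
  "edge_coeffs E F = (\<lambda>(v, w, k). if lag_edge E v w k
     then of_bool ((v, w) \<in> F \<and> k = (SOME k. lag_edge E v w k)) else undefined)"

lemma finite_lags:
  assumes "time_series_graph (E :: 'v::finite tsgraph)"
  shows "finite {k. lag_edge E v w k}"
  using assms finite_subset[of "{k. lag_edge E v w k}"] unfolding time_series_graph_def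
  by (metis (mono_tags, lifting) finite_nat_set_iff_bounded_le mem_Collect_eq)

lemma lag_sum_edge_coeffs:
  fixes E :: "'v::finite tsgraph"
  assumes E: "time_series_graph E" and F: "F \<subseteq> process_graph E"
  shows "lag_sum E (edge_coeffs E F) v w = of_bool ((v, w) \<in> F)"
proof -
  have "lag_sum E (edge_coeffs E F) v w =
      (\<Sum>k | lag_edge E v w k. if k = (SOME k. lag_edge E v w k) then of_bool ((v, w) \<in> F) else 0)"
    unfolding lag_sum_def by (rule sum.cong) (auto simp: edge_coeffs_def)
  also have "\<dots> = (if lag_edge E v w (SOME k. lag_edge E v w k) then of_bool ((v, w) \<in> F) else 0)"
    by (subst sum.delta) (use finite_lags[OF E] in auto)
  also have "\<dots> = of_bool ((v, w) \<in> F)"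
  proof (cases "(v, w) \<in> F")
    case True
    then have "\<exists>k. lag_edge E v w k" using F by (auto simp: process_graph_def)
    then show ?thesis by (simp add: someI_ex)
  qed simp
  finally show ?thesis .
qed

lemma rtrancl_single_valued_step:
  assumes "single_valued F" "acyclic F" "(u, w) \<in> F"
  shows "(u, x) \<in> F\<^sup>* \<longleftrightarrow> u = x \<or> (w, x) \<in> F\<^sup>*" "\<not> (u = x \<and> (w, x) \<in> F\<^sup>*)"
proof -
  show "(u, x) \<in> F\<^sup>* \<longleftrightarrow> u = x \<or> (w, x) \<in> F\<^sup>*"
    using assms by (metis converse_rtranclE converse_rtrancl_into_rtrancl rtrancl.rtrancl_refl single_valuedD)
  show "\<not> (u = x \<and> (w, x) \<in> F\<^sup>*)"
    using assms by (metis acyclic_def rtrancl_into_trancl2)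
qed

text \<open>
  Since \<open>F\<close> is acyclic and every vertex has at most one \<open>F\<close>-successor, there is at most one \<open>F\<close>-path between two vertices, of
  gain \<open>1\<close>.
\<close>

lemma matrix_inv_path_indicator:
  fixes F :: "'v::finite rel"
  assumes "single_valued F" "acyclic F"
  shows "matrix_inv (mat 1 - (\<chi> u w. of_bool ((u, w) \<in> F))) = (\<chi> u x. (of_bool ((u, x) \<in> F\<^sup>*) :: real))"
proof (rule matrix_inv_eqI)
  let ?h = "\<chi> u w. (of_bool ((u, w) \<in> F) :: real)" and ?B = "\<chi> u x. (of_bool ((u, x) \<in> F\<^sup>*) :: real)"
  have "?B $ u $ x - (\<Sum>w\<in>UNIV. ?h $ u $ w * ?B $ w $ x) = of_bool (u = x)" for u x
  proof (cases "u \<in> Domain F")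
    case True
    then obtain w where w: "(u, w) \<in> F" by blast
    then have "(u, v) \<in> F \<longleftrightarrow> v = w" for v using assms(1) by (auto dest: single_valuedD)
    then have "(\<Sum>v\<in>UNIV. ?h $ u $ v * ?B $ v $ x) = of_bool ((w, x) \<in> F\<^sup>*)"
      by (simp add: of_bool_def mult_delta_left)
    then show ?thesis using rtrancl_single_valued_step[OF assms w, of x] by auto
  next
    case False
    then have "(u, x) \<in> F\<^sup>* \<longleftrightarrow> u = x" by (metis DomainI converse_rtranclE rtrancl.rtrancl_refl)
    moreover have "(\<Sum>v\<in>UNIV. ?h $ u $ v * ?B $ v $ x) = 0" using False by (intro sum.neutral) auto
    ultimately show ?thesis by simp
  qed
  then have "?B - ?h ** ?B = mat 1"
    by (simp add: vec_eq_iff matrix_matrix_mult_def mat_def of_bool_def)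
  then show "(mat 1 - ?h) ** ?B = mat 1" by (simp add: matrix_diff_rdistrib)
qed

lemma det_path_system:
  fixes E :: "'v::finite tsgraph"
  assumes E: "time_series_graph E" and G: "acyclic (process_graph E)"
    and P: "path_system (process_graph E) U X g F"
  shows "det (bordered_minor U id g (matrix_inv (mat 1 - transfer_at_1 E (edge_coeffs E F)))) = 1"
proof -
  have F: "F \<subseteq> process_graph E" "single_valued F" "\<forall>u\<in>U. \<forall>w\<in>U. (w, g u) \<in> F\<^sup>* \<longleftrightarrow> w = u"
    using P by (auto simp: path_system_def)
  have noloop: "(w, w) \<notin> F" for w using F(1) by (auto simp: process_graph_def)
  have "transfer_at_1 E (edge_coeffs E F) = (\<chi> u w. of_bool ((u, w) \<in> F))"
    using F(1) noloop by (auto simp: vec_eq_iff transfer_at_1_def lag_sum_edge_coeffs[OF E F(1)])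
  then have "matrix_inv (mat 1 - transfer_at_1 E (edge_coeffs E F)) = (\<chi> u x. of_bool ((u, x) \<in> F\<^sup>*))"
    using matrix_inv_path_indicator[OF F(2) acyclic_subset[OF G F(1)]] by simp
  then have "bordered_minor U id g (matrix_inv (mat 1 - transfer_at_1 E (edge_coeffs E F))) = mat 1"
    using F(3) by (auto simp: bordered_minor_def vec_eq_iff mat_def)
  then show ?thesis by simp
qed

text \<open>
  Only the vertices of \<open>U\<close> carry noise, so the sum over tops is a product of two square matrices
  indexed by \<open>U\<close>; this is the one surviving term of the Cauchy-Binet formula.
\<close>

lemma bordered_minor_factor:
  fixes A :: "real ^'v::finite ^'v"
  shows "det (bordered_minor U g g' (\<chi> x y. \<Sum>u\<in>UNIV. A $ u $ x * of_bool (u \<in> U) * A $ u $ y)) =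
    det (bordered_minor U id g A) * det (bordered_minor U id g' A)"
proof -
  let ?L = "bordered_minor U id g A" and ?R = "bordered_minor U id g' A"
  let ?S = "\<chi> x y. \<Sum>u\<in>UNIV. A $ u $ x * of_bool (u \<in> U) * A $ u $ y"
  have "bordered_minor U g g' ?S $ i $ j = (\<Sum>u\<in>UNIV. ?L $ u $ i * ?R $ u $ j)" for i j
  proof -
    consider "i \<in> U" "j \<in> U" | "i \<in> U" "j \<notin> U" | "i \<notin> U" by blast
    then show ?thesis
    proof cases
      case 1
      then show ?thesis by (auto simp: bordered_minor_def intro!: sum.cong)
    next
      case 2
      then have "?L $ u $ i * ?R $ u $ j = 0" for u by (auto simp: bordered_minor_def)
      then have "(\<Sum>u\<in>UNIV. ?L $ u $ i * ?R $ u $ j) = 0" by (intro sum.neutral) blast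
      with 2 show ?thesis by (auto simp: bordered_minor_def)
    next
      case 3
      then have "(\<Sum>u\<in>UNIV. ?L $ u $ i * ?R $ u $ j) = (\<Sum>u\<in>UNIV. if u = i then ?R $ i $ j else 0)"
        by (intro sum.cong) (auto simp: bordered_minor_def)
      with 3 show ?thesis by (auto simp: bordered_minor_def)
    qed
  qed
  then have "bordered_minor U g g' ?S = transpose ?L ** ?R"
    by (simp add: vec_eq_iff matrix_matrix_mult_def transpose_def)
  then show ?thesis by (simp add: det_mul det_transpose)
qed


lemma lag_sum_line:
  "lag_sum E (\<lambda>i. x i + t * (y i - x i)) v w = lag_sum E x v w + t * (lag_sum E y v w - lag_sum E x v w)"
  by (simp add: lag_sum_def sum.distrib sum_subtractf flip: sum_distrib_left)

text \<open>
  The left factor of the minor is nonzero when the edges of \<open>FL\<close> are switched on, the right factor when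
  those of \<open>FR\<close> are. On the line through these two points self-loops have weight \<open>0\<close>, so the line stays within the
  regular parameters, and some point on it is good for both factors.
\<close>

lemma nonsingular_minor_exists:
  fixes E :: "'v::finite tsgraph"
  assumes E: "time_series_graph E" and G: "acyclic (process_graph E)"
    and PL: "path_system (process_graph E) U X g FL" and PR: "path_system (process_graph E) U Y g' FR"
  obtains \<Phi> \<omega> where "\<Phi> \<in> extensional (coeff_index E)" "\<And>u. \<omega> u \<ge> 0" "case_sum \<Phi> \<omega> \<in> regular_params E"
    "det (bordered_minor U g g' (spectrum_at_1 E \<Phi> \<omega>)) \<noteq> 0"
proof -
  let ?x = "edge_coeffs E FL" and ?y = "edge_coeffs E FR"
  let ?\<omega> = "\<lambda>u. of_bool (u \<in> U) :: real"
  define a where "a = case_sum ?x ?\<omega>"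
  define b where "b = case_sum (\<lambda>i. ?y i - ?x i) (\<lambda>_::'v. 0 :: real)"
  define \<Phi> where "\<Phi> t = (\<lambda>i. ?x i + t * (?y i - ?x i))" for t
  have line: "(\<lambda>i. a i + t * b i) = case_sum (\<Phi> t) ?\<omega>" for t
    by (auto simp: a_def b_def \<Phi>_def fun_eq_iff split: sum.split)
  have line_Inl: "(\<lambda>i. a (Inl i) + t * b (Inl i)) = \<Phi> t" for t
    by (simp add: a_def b_def \<Phi>_def)
  have F: "FL \<subseteq> process_graph E" "FR \<subseteq> process_graph E" using PL PR by (auto simp: path_system_def)
  have loop: "lag_sum E (\<Phi> t) w w = 0" for t w
    using F unfolding \<Phi>_def lag_sum_line lag_sum_edge_coeffs[OF E F(1)] lag_sum_edge_coeffs[OF E F(2)]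
    by (auto simp: process_graph_def)
  have reg: "(\<lambda>i. a i + t * b i) \<in> regular_params E" for t
    unfolding line regular_params_def by (simp add: loop)
  let ?A = "\<lambda>\<theta> :: 'v param. matrix_inv (mat 1 - transfer_at_1 E (\<lambda>i. \<theta> (Inl i)))"
  let ?q = "\<lambda>g \<theta>. det (bordered_minor U id g (?A \<theta>))"
  have rat: "ratfun_on (regular_params E) (?q f)" for f
    by (intro ratfun_on_bordered_minor ratfun_on_path_gain[OF G])
  have "\<Phi> 0 = ?x" "\<Phi> 1 = ?y" by (auto simp: \<Phi>_def)
  then have "?q g (\<lambda>i. a i + 0 * b i) \<noteq> 0" "?q g' (\<lambda>i. a i + 1 * b i) \<noteq> 0"
    unfolding line_Inl by (simp_all add: det_path_system[OF E G PL] det_path_system[OF E G PR])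
  then obtain t where t: "?q g (\<lambda>i. a i + t * b i) \<noteq> 0" "?q g' (\<lambda>i. a i + t * b i) \<noteq> 0"
    using ratfun_on_common_nonzero[OF rat rat reg] by blast
  show ?thesis
  proof
    show "\<Phi> t \<in> extensional (coeff_index E)"
      by (auto simp: extensional_def \<Phi>_def edge_coeffs_def coeff_index_def)
    show "?\<omega> u \<ge> 0" for u by simp
    show "case_sum (\<Phi> t) ?\<omega> \<in> regular_params E" using reg[of t] unfolding line .
    have "spectrum_at_1 E (\<Phi> t) ?\<omega> = (\<chi> x y. \<Sum>u\<in>UNIV.
        matrix_inv (mat 1 - transfer_at_1 E (\<Phi> t)) $ u $ x * of_bool (u \<in> U) *
        matrix_inv (mat 1 - transfer_at_1 E (\<Phi> t)) $ u $ y)"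
      unfolding spectrum_at_1_def loop by simp
    then show "det (bordered_minor U g g' (spectrum_at_1 E (\<Phi> t) ?\<omega>)) \<noteq> 0"
      using t unfolding line_Inl by (simp add: bordered_minor_factor)
  qed
qed

section \<open>Generic lower bound\<close>

text \<open>
  The points of the segment from \<open>(0, 1)\<close> to \<open>(\<Phi>, \<omega>)\<close> that are close to \<open>(0, 1)\<close> are stable.
\<close>

lemma stable_params_near_0:
  fixes E :: "'v::finite tsgraph"
  assumes \<Phi>: "\<Phi> \<in> extensional (coeff_index E)" and \<omega>: "\<And>u. \<omega> u \<ge> 0"
  defines "C \<equiv> (\<Sum>v\<in>UNIV. \<Sum>w\<in>UNIV. \<Sum>k | lag_edge E v w k. \<bar>\<Phi> (v, w, k)\<bar>)"
  assumes t: "0 < t" "t < 1" "t * C < 1"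
  shows "(restrict (\<lambda>i. t * \<Phi> i) (coeff_index E), \<lambda>u. 1 + t * (\<omega> u - 1)) \<in> stable_params E"
proof -
  let ?\<Phi> = "restrict (\<lambda>i. t * \<Phi> i) (coeff_index E)"
  have total: "(\<Sum>v\<in>UNIV. \<Sum>w\<in>UNIV. \<Sum>k | lag_edge E v w k. \<bar>?\<Phi> (v, w, k)\<bar>) = t * C"
    using t unfolding C_def sum_distrib_left
    by (intro sum.cong) (auto simp: coeff_index_def abs_mult)
  have "(\<Sum>k | lag_edge E v v k. \<bar>?\<Phi> (v, v, k)\<bar>) < 1" for v
  proof -
    have "(\<Sum>k | lag_edge E v v k. \<bar>?\<Phi> (v, v, k)\<bar>) \<le> (\<Sum>w\<in>UNIV. \<Sum>k | lag_edge E v w k. \<bar>?\<Phi> (v, w, k)\<bar>)"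
      by (rule member_le_sum[of v UNIV "\<lambda>w. \<Sum>k | lag_edge E v w k. \<bar>?\<Phi> (v, w, k)\<bar>"])
         (auto intro: sum_nonneg)
    also have "\<dots> \<le> (\<Sum>v\<in>UNIV. \<Sum>w\<in>UNIV. \<Sum>k | lag_edge E v w k. \<bar>?\<Phi> (v, w, k)\<bar>)"
      by (rule member_le_sum[of v UNIV "\<lambda>v. \<Sum>w\<in>UNIV. \<Sum>k | lag_edge E v w k. \<bar>?\<Phi> (v, w, k)\<bar>"])
         (auto intro!: sum_nonneg)
    also have "\<dots> < 1" using total t by simp
    finally show ?thesis .
  qed
  then have "?\<Phi> \<in> stable_coeffs E"
    using total t by (simp add: stable_coeffs_def coeff_space_def)
  moreover have "1 + t * (\<omega> u - 1) > 0" for u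
  proof -
    have "t * \<omega> u \<ge> 0" using t \<omega> by simp
    then show ?thesis using t by (simp add: algebra_simps)
  qed
  ultimately show ?thesis by (simp add: stable_params_def)
qed

text \<open>
  Both claims follow from one polynomial: the numerator \<open>p\<close> of the evaluated minor, which is nonzero at
  the point of \<open>nonsingular_minor_exists\<close>. Its zero set is a null set, and it meets the line from the stable point
  \<open>(0, 1)\<close> to the good point in finitely many points, so that stable points outside it remain.
\<close>

theorem spectrum_rank_ge_generically:
  fixes E :: "'v::finite tsgraph"
  assumes E: "time_series_graph E" and G: "acyclic (process_graph E)"
    and PL: "path_system (process_graph E) U X g FL" and PR: "path_system (process_graph E) U Y g' FR"
  shows "{(\<Phi>, \<omega>) \<in> stable_params E. spectrum_rank E \<Phi> \<omega> X Y < card U} \<in> null_sets (param_measure E)"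
      (is "?bad \<in> _")
    and "\<exists>(\<Phi>, \<omega>) \<in> stable_params E. card U \<le> spectrum_rank E \<Phi> \<omega> X Y"
proof -
  obtain \<Phi>0 \<omega>0 where z0: "\<Phi>0 \<in> extensional (coeff_index E)" "\<And>u. \<omega>0 u \<ge> 0"
      "case_sum \<Phi>0 \<omega>0 \<in> regular_params E" "det (bordered_minor U g g' (spectrum_at_1 E \<Phi>0 \<omega>0)) \<noteq> 0"
    using nonsingular_minor_exists[OF assms] by metis
  let ?q = "\<lambda>\<theta> :: 'v param. det (bordered_minor U g g' (spectrum_at_1 E (\<lambda>i. \<theta> (Inl i)) (\<lambda>i. \<theta> (Inr i))))"
  have "ratfun_on (regular_params E) ?q"
    by (intro ratfun_on_bordered_minor ratfun_on_spectrum_at_1[OF G])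
  then obtain p d where pd: "polyfun p" "polyfun d"
      "\<forall>\<theta>\<in>regular_params E. d \<theta> \<noteq> 0 \<and> ?q \<theta> = p \<theta> / d \<theta>" by (rule ratfun_onE)
  have p0: "p (case_sum \<Phi>0 \<omega>0) \<noteq> 0"
    using bspec[OF pd(3) z0(3)] z0(4) by auto
  have rank: "card U \<le> spectrum_rank E \<Phi> \<omega> X Y"
    if st: "(\<Phi>, \<omega>) \<in> stable_params E" and nz: "p (case_sum \<Phi> \<omega>) \<noteq> 0" for \<Phi> \<omega>
  proof (rule card_le_spectrum_rank[OF G])
    show \<Phi>: "\<Phi> \<in> stable_coeffs E" using st by (simp add: stable_params_def)
    have "case_sum \<Phi> \<omega> \<in> regular_params E"
      using lag_sum_neq_1_if_stable[OF \<Phi>] by (simp add: regular_params_def)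
    from bspec[OF pd(3) this] nz show "det (bordered_minor U g g' (spectrum_at_1 E \<Phi> \<omega>)) \<noteq> 0"
      by simp
    show "g ` U \<subseteq> X" "g' ` U \<subseteq> Y" using PL PR by (auto simp: path_system_def)
  qed
  show "?bad \<in> null_sets (param_measure E)"
  proof -
    let ?M = "PiM (coeff_index E) (\<lambda>_. lborel :: real measure) \<Otimes>\<^sub>M PiM (UNIV :: 'v set) (\<lambda>_. lborel :: real measure)"
    have "AE z in ?M. p (case_sum (fst z) (snd z)) \<noteq> 0"
      by (rule AE_polyfun_nonzero_pair[OF finite_coeff_index[OF E] _ pd(1) z0(1) _ p0]) auto
    then obtain N where N: "N \<in> null_sets ?M" "{z \<in> space ?M. \<not> p (case_sum (fst z) (snd z)) \<noteq> 0} \<subseteq> N"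
      unfolding eventually_ae_filter by blast
    have "?bad \<subseteq> N"
    proof (clarify)
      fix \<Phi> \<omega> assume st: "(\<Phi>, \<omega>) \<in> stable_params E" and "spectrum_rank E \<Phi> \<omega> X Y < card U"
      then have "p (case_sum \<Phi> \<omega>) = 0" using rank[OF st] by force
      moreover have "(\<Phi>, \<omega>) \<in> space ?M"
        using st by (simp add: space_pair_measure space_PiM stable_params_def stable_coeffs_def coeff_space_def)
      ultimately show "(\<Phi>, \<omega>) \<in> N" using N(2) by auto
    qed
    then show ?thesis
      unfolding param_measure_def using null_sets_completionI[OF N(1)] by (rule null_sets_completion_subset)
  qed
  show "\<exists>(\<Phi>, \<omega>) \<in> stable_params E. card U \<le> spectrum_rank E \<Phi> \<omega> X Y"
  proof -
    define C where "C = (\<Sum>v\<in>UNIV. \<Sum>w\<in>UNIV. \<Sum>k | lag_edge E v w k. \<bar>\<Phi>0 (v, w, k)\<bar>)"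
    have C: "C \<ge> 0" unfolding C_def by (intro sum_nonneg) simp
    let ?I = "coeff_index E"
    define a where "a = case_sum (restrict (\<lambda>_. 0) ?I) (\<lambda>_::'v. 1 :: real)"
    define b where "b = case_sum (\<lambda>i. if i \<in> ?I then \<Phi>0 i else 0) (\<lambda>u. \<omega>0 u - 1)"
    \<comment> \<open>Coordinates outside the index set must keep the value \<open>undefined\<close> along the line.\<close>
    have line: "(\<lambda>i. a i + t * b i) = case_sum (restrict (\<lambda>i. t * \<Phi>0 i) ?I) (\<lambda>u. 1 + t * (\<omega>0 u - 1))" for t
      by (auto simp: a_def b_def fun_eq_iff restrict_def split: sum.split)
    have "restrict \<Phi>0 ?I = \<Phi>0" using z0(1) by (rule extensional_restrict)
    then have "p (\<lambda>i. a i + 1 * b i) \<noteq> 0" using p0 unfolding line by simp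
    then have fin: "finite {t. p (\<lambda>i. a i + t * b i) = 0}" by (rule polyfun_line_finite_zeros[OF pd(1)])
    have "infinite {0<..<min 1 (1 / (C + 1))}" using C by (intro infinite_Ioo) auto
    then have "infinite ({0<..<min 1 (1 / (C + 1))} - {t. p (\<lambda>i. a i + t * b i) = 0})"
      using fin by (rule Diff_infinite_finite[rotated])
    then obtain t where "t \<in> {0<..<min 1 (1 / (C + 1))} - {t. p (\<lambda>i. a i + t * b i) = 0}"
      using infinite_imp_nonempty by blast
    then have t: "0 < t" "t < 1" "t < 1 / (C + 1)" "p (\<lambda>i. a i + t * b i) \<noteq> 0" by simp_all
    have "t * (C + 1) < 1" using t(3) C by (simp add: field_simps)
    then have "t * C < 1" using t(1) by (simp add: algebra_simps)
    then have "(restrict (\<lambda>i. t * \<Phi>0 i) ?I, \<lambda>u. 1 + t * (\<omega>0 u - 1)) \<in> stable_params E"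
      using t(1,2) unfolding C_def by (intro stable_params_near_0 z0) auto
    then show ?thesis using rank t(4) unfolding line by blast
  qed
qed

section \<open>Rank of the spectrum and trek separation\<close>

theorem rank_le_separator:
  fixes E :: "'v::finite tsgraph"
  assumes "acyclic (process_graph E)" and "t_separates (process_graph E) ZX ZY X Y"
  shows "spectrum_rank E \<Phi> \<omega> X Y \<le> card ZX + card ZY"
  unfolding spectrum_rank_def spectrum_def internal_spectrum_def
  by (rule rank_le_if_t_separates[OF assms(1) _ _ assms(2)])
     (auto simp: transfer_function_def map_matrix_def ratfun_star_0 split: if_splits)

theorem theorem3:
  fixes G :: "'v::finite rel" and E :: "'v tsgraph" and X Y :: "'v set" and r :: nat
  assumes "acyclic G" and "E \<in> time_series_graphs G"
  shows "((\<forall>(\<Phi>, \<omega>) \<in> stable_params E. spectrum_rank E \<Phi> \<omega> X Y \<le> r) \<longleftrightarrow>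
          (\<exists>ZX ZY. card ZX + card ZY \<le> r \<and> t_separates G ZX ZY X Y)) \<and>
         generic_rank G X Y (Min {card ZX + card ZY | ZX ZY. t_separates G ZX ZY X Y})"
proof -
  let ?sizes = "{card ZX + card ZY | ZX ZY. t_separates G ZX ZY X Y}"
  let ?m = "Min ?sizes"
  have "?sizes = (\<lambda>(ZX, ZY). card ZX + card ZY) ` {(ZX, ZY). t_separates G ZX ZY X Y}" by auto
  then have fin: "finite ?sizes" by simp
  have "t_separates G X {} X Y"
    by (auto simp: t_separates_def trek_def directed_path_def) (metis disjoint_iff last_in_set)
  then have "?sizes \<noteq> {}" by blast
  with fin have "?m \<in> ?sizes" by (rule Min_in)
  then obtain ZX ZY where Z: "t_separates G ZX ZY X Y" "card ZX + card ZY = ?m" by auto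
  have "?m \<le> card ZX' + card ZY'" if "t_separates G ZX' ZY' X Y" for ZX' ZY'
    using fin that by (intro Min_le) auto
  then obtain U g g' FL FR where U: "card U = ?m" "path_system G U X g FL" "path_system G U Y g' FR"
    by (rule trek_systems_exist)
  have le: "spectrum_rank E' \<Phi> \<omega> X Y \<le> ?m" if "E' \<in> time_series_graphs G" for E' \<Phi> \<omega>
    using rank_le_separator[of E' ZX ZY X Y] Z that assms(1) by (simp add: time_series_graphs_def)
  have null: "{(\<Phi>, \<omega>) \<in> stable_params E'. spectrum_rank E' \<Phi> \<omega> X Y < ?m} \<in> null_sets (param_measure E')"
    and attained: "\<exists>(\<Phi>, \<omega>) \<in> stable_params E'. ?m \<le> spectrum_rank E' \<Phi> \<omega> X Y"
    if "E' \<in> time_series_graphs G" for E'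
    using spectrum_rank_ge_generically[of E' U X g FL Y g' FR] U that assms(1)
    by (simp_all add: time_series_graphs_def)
  have "generic_rank G X Y ?m"
    unfolding generic_rank_def generic_rank_ts_def
  proof
    fix E' assume E': "E' \<in> time_series_graphs G"
    have "spectrum_rank E' \<Phi> \<omega> X Y \<noteq> ?m \<longleftrightarrow> spectrum_rank E' \<Phi> \<omega> X Y < ?m" for \<Phi> \<omega>
      using le[OF E', of \<Phi> \<omega>] by linarith
    then show "{(\<Phi>, \<omega>) \<in> stable_params E'. spectrum_rank E' \<Phi> \<omega> X Y \<noteq> ?m} \<in> null_sets (param_measure E')"
      using null[OF E'] by simp
  qed
  moreover have "(\<forall>(\<Phi>, \<omega>) \<in> stable_params E. spectrum_rank E \<Phi> \<omega> X Y \<le> r) \<longleftrightarrow>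
      (\<exists>ZX ZY. card ZX + card ZY \<le> r \<and> t_separates G ZX ZY X Y)"
  proof
    assume r: "\<forall>(\<Phi>, \<omega>) \<in> stable_params E. spectrum_rank E \<Phi> \<omega> X Y \<le> r"
    then have "?m \<le> r" using attained[OF assms(2)] by force
    then show "\<exists>ZX ZY. card ZX + card ZY \<le> r \<and> t_separates G ZX ZY X Y" using Z by metis
  next
    assume "\<exists>ZX ZY. card ZX + card ZY \<le> r \<and> t_separates G ZX ZY X Y"
    then obtain ZX' ZY' where Z': "card ZX' + card ZY' \<le> r" "t_separates G ZX' ZY' X Y" by blast
    have "spectrum_rank E \<Phi> \<omega> X Y \<le> card ZX' + card ZY'" for \<Phi> \<omega>
      using rank_le_separator[of E ZX' ZY' X Y] Z'(2) assms by (simp add: time_series_graphs_def)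
    with Z'(1) show "\<forall>(\<Phi>, \<omega>) \<in> stable_params E. spectrum_rank E \<Phi> \<omega> X Y \<le> r"
      by (auto intro: order_trans)
  qed
  ultimately show ?thesis by blast
qed

end
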